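(* Let $x=\cos\theta\in[-1,1]$, $|t|<(1-q)^3$, let $a,b,c,d\in\mathbb R$ or occur in complex conjugate pairs if complex, with $\max(|a|,|b|,|c|,|d|)<1$, and $0<|q|<1$. Then, with $\alpha$ a free parameter, $${}_2\phi_1\!\left(ae^{i\theta},be^{i\theta};ab;q,te^{-i\theta}\right)\,{}_2\phi_1\!\left(ce^{-i\theta},de^{-i\theta};cd;q,te^{i\theta}\right)=\sum_{n=0}^\infty\frac{t^n\left(\alpha bcd/q,\pm\sqrt{abcd/q},\pm\sqrt{abcd};q\right)_n}{\left(ab,cd,abcd/q,\pm\sqrt{\alpha bcd/q},\pm\sqrt{\alpha bcd};q\right)_n}$$ $$\times\;{}_4\phi_3\!\left(a/\alpha,bcq^n,bdq^n,abcdq^{2n-1};\ abq^n,abcdq^{n-1},\alpha bcdq^{2n};\ q,\alpha t\right)\frac{p_n(x;\alpha,b,c,d|q)}{(q;q)_n}.$$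
   Context: Notation: $(a;q)_0=1$, $(a;q)_n=\prod_{j=0}^{n-1}(1-aq^j)$, $(a;q)_\infty=\prod_{j\ge0}(1-aq^j)$, $(a_1,\dots,a_r;q)_n=\prod_i(a_i;q)_n$. In a list of parameters, $\pm a$ stands for the two entries $a,-a$. The basic hypergeometric series, with upper parameters listed before the first semicolon and lower parameters before the second, is $${}_r\phi_s(a_1,\dots,a_r;b_1,\dots,b_s;q,z)=\sum_{k=0}^\infty\frac{(a_1,\dots,a_r;q)_k}{(q,b_1,\dots,b_s;q)_k}\left((-1)^kq^{\binom k2}\right)^{1+s-r}z^k.$$ The Askey-Wilson polynomials are, for $x=\cos\theta$, $$p_n(x;a,b,c,d|q)=a^{-n}(ab,ac,ad;q)_n\,{}_4\phi_3\!\left(q^{-n},abcdq^{n-1},ae^{i\theta},ae^{-i\theta};\ ab,ac,ad;\ q,q\right).$$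
   Formalization: Also assumed, since otherwise a series diverges or a denominator vanishes: |t|<1 (new only for q<0), |αt|<1, α≠0, abcd≠q, and for all k≥0 αbcd q^k≠q and αb q^k, αc q^k, αd q^k≠1. *)

theory Defs
  imports "HOL-Analysis.Analysis"
begin

definition qpoch :: "complex \<Rightarrow> complex \<Rightarrow> nat \<Rightarrow> complex" where
  "qpoch a q n = (\<Prod>j<n. 1 - a * q ^ j)"

definition qpochs :: "complex list \<Rightarrow> complex \<Rightarrow> nat \<Rightarrow> complex" where
  "qpochs as q n = (\<Prod>a\<leftarrow>as. qpoch a q n)"

text \<open>
  The series \<open>\<^sub>r\<phi>\<^sub>s\<close> with upper parameters \<open>as\<close> and lower parameters \<open>bs\<close>, where \<open>r\<close> and \<open>s\<close>
  are the lengths of the two lists. As usual for \<open>suminf\<close>, the value is meaningful only if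
  the series converges and no denominator vanishes; if some upper parameter is \<open>q\<^sup>-\<^sup>n\<close>, all
  terms with \<open>k > n\<close> are zero.
\<close>

definition basic_hypergeom ::
    "complex list \<Rightarrow> complex list \<Rightarrow> complex \<Rightarrow> complex \<Rightarrow> complex" where
  "basic_hypergeom as bs q z =
     (\<Sum>k. qpochs as q k / qpochs (q # bs) q k
          * ((-1) ^ k * q ^ (k choose 2)) powi (1 + int (length bs) - int (length as))
          * z ^ k)"

text \<open>
  The Askey--Wilson polynomial at \<open>x = cos \<theta>\<close>. The right-hand side is invariant under
  \<open>\<theta> \<mapsto> -\<theta>\<close> and \<open>\<theta> \<mapsto> \<theta> + 2\<pi>\<close>, so it does not matter that \<open>\<theta>\<close> is taken to be the
  principal value \<open>Arccos x\<close>.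
\<close>

definition askey_wilson ::
    "nat \<Rightarrow> complex \<Rightarrow> complex \<Rightarrow> complex \<Rightarrow> complex \<Rightarrow> complex \<Rightarrow> complex \<Rightarrow> complex" where
  "askey_wilson n x a b c d q =
     (let \<theta> = Arccos x in
        a powi (- int n) * qpochs [a * b, a * c, a * d] q n
        * basic_hypergeom
            [q powi (- int n), a * b * c * d * q powi (int n - 1),
             a * exp (\<i> * \<theta>), a * exp (- \<i> * \<theta>)]
            [a * b, a * c, a * d] q q)"

end

theory Submission
  imports Defs
begin

text \<open>
  Write \<open>E = e\<^sup>i\<^sup>\<theta>\<close>. Multiplying the two \<open>\<^sub>2\<phi>\<^sub>1\<close> series on the left as power series in \<open>t\<close> gives
  \<open>\<Sum>\<^sub>N t\<^sup>N U\<^sub>N(a,b,c,d) / (q,ab,cd;q)\<^sub>N\<close>, where \<open>U\<^sub>N\<close> (\<open>aw_sum\<close> below) is the explicit finite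
  convolution of their coefficients. Two facts about \<open>U\<^sub>N\<close> carry the theorem.

  (1) \<open>U\<^sub>N\<close> is the Askey--Wilson polynomial (\<open>aw_sum_sears\<close>, \<open>askey_wilson_eq_aw_sum\<close>). This is
  a case of Sears' transformation of a balanced terminating \<open>\<^sub>4\<phi>\<^sub>3\<close>, obtained by using the
  \<open>q\<close>-Saalschuetz sum twice, once to expand a product and once to evaluate the inner sum.
  As \<open>U\<^sub>N\<close> is visibly symmetric in \<open>a\<close> and \<open>b\<close>, the polynomial can be expanded in the basis
  \<open>(aE,a/E;q)\<^sub>j\<close> as well as in \<open>(bE,b/E;q)\<^sub>j\<close>.

  (2) Changing \<open>a\<close> to \<open>\<alpha>\<close> is a triangular transformation,
  \<open>U\<^sub>N(a,b,c,d) = \<Sum>\<^sub>n c\<^sub>N\<^sub>,\<^sub>n U\<^sub>n(\<alpha>,b,c,d)\<close>, with Askey and Wilson's connection coefficients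
  (\<open>connection\<close>). In the basis \<open>(bE,b/E;q)\<^sub>j\<close>, which does not involve the parameter that changes,
  comparing coefficients leaves a terminating very-well-poised \<open>\<^sub>6\<phi>\<^sub>5\<close> sum
  (\<open>very_well_poised_sum\<close>). This argument divides by \<open>b\<close>; the case \<open>b = 0\<close> follows by continuity.

  Inserting (2) in the power series and writing \<open>N = n + m\<close> gives a double series. Its sum along
  the diagonals is the left-hand side, and its sum over \<open>m\<close> for fixed \<open>n\<close> is the \<open>\<^sub>4\<phi>\<^sub>3\<close> of the
  right-hand side. All shifted factorials that occur are bounded, also from below when they are
  in a denominator, so the terms are \<open>O((n + 1) |t|\<^sup>n |\<alpha>t|\<^sup>m)\<close> and the order of summation
  may be changed.

  The two summation theorems are proved by telescoping: for each there is a closed form of the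
  partial sums of the difference between level \<open>k + 1\<close> and the expected multiple of level \<open>k\<close>.
  Both are stated in a homogeneous form without division by parameters, since \<open>a\<close>, \<open>b\<close>, \<open>c\<close> and \<open>d\<close>
  may vanish.
\<close>

section \<open>Shifted factorials and Gaussian binomial coefficients\<close>

lemma qpoch_0 [simp]: "qpoch a q 0 = 1"
  by (simp add: qpoch_def)

lemma qpoch_zero_left [simp]: "qpoch 0 q n = 1"
  by (simp add: qpoch_def)

lemma qpoch_Suc: "qpoch a q (Suc n) = qpoch a q n * (1 - a * q ^ n)"
  by (simp add: qpoch_def)

lemma qpoch_add: "qpoch a q (m + n) = qpoch a q m * qpoch (a * q ^ m) q n"
  by (induction n) (simp_all add: qpoch_Suc power_add mult.assoc)

lemma qpoch_Suc_left: "qpoch a q (Suc n) = (1 - a) * qpoch (a * q) q n"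
  using qpoch_add[of a q 1 n] by (simp add: qpoch_Suc)

lemma qpoch_mult_shifted:
  "qpoch (a * q ^ j) q i * qpoch (a * q ^ (j + i)) q m = qpoch (a * q ^ j) q (i + m)"
  by (simp add: qpoch_add[of _ _ i] power_add mult_ac)

text \<open>
  The parameters \<open>\<plusminus>s\<close>, \<open>\<plusminus>r\<close> contribute \<open>(s\<^sup>2;q\<^sup>2)\<^sub>n (s\<^sup>2q;q\<^sup>2)\<^sub>n\<close>, whose factors interlace.
\<close>

lemma qpoch_square_split:
  assumes "r\<^sup>2 = s\<^sup>2 * q"
  shows "qpoch s q n * qpoch (- s) q n * qpoch r q n * qpoch (- r) q n = qpoch (s\<^sup>2) q (2 * n)"
proof (induction n)
  case (Suc n)
  have "q ^ (2 * n) = (q ^ n)\<^sup>2" by (simp add: power_even_eq)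
  then have "qpoch (s\<^sup>2) q (2 * Suc n)
      = qpoch (s\<^sup>2) q (2 * n) * (1 - s\<^sup>2 * (q ^ n)\<^sup>2) * (1 - r\<^sup>2 * (q ^ n)\<^sup>2)"
    by (simp add: qpoch_Suc assms mult_ac)
  also have "\<dots> = qpoch s q (Suc n) * qpoch (- s) q (Suc n) * qpoch r q (Suc n) * qpoch (- r) q (Suc n)"
    unfolding Suc[symmetric] qpoch_Suc by algebra
  finally show ?case ..
qed simp

text \<open>
  The homogeneous form of the shifted factorial: for \<open>u \<noteq> 0\<close> it is \<open>u\<^sup>n (v/u;q)\<^sub>n\<close>, and it stays
  meaningful for \<open>u = 0\<close>. It lets the identities below hold for vanishing parameters too.
\<close>

definition qdiff :: "complex \<Rightarrow> complex \<Rightarrow> complex \<Rightarrow> nat \<Rightarrow> complex" where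
  "qdiff u v q n = (\<Prod>i<n. u - v * q ^ i)"

lemma qdiff_0 [simp]: "qdiff u v q 0 = 1"
  by (simp add: qdiff_def)

lemma qdiff_Suc: "qdiff u v q (Suc n) = qdiff u v q n * (u - v * q ^ n)"
  by (simp add: qdiff_def)

lemma qpoch_eq_qdiff: "qpoch x q n = qdiff 1 x q n"
  by (simp add: qpoch_def qdiff_def)

lemma q_power_neq_1: "norm (q::complex) < 1 \<Longrightarrow> q * q ^ k \<noteq> 1"
  using power_Suc_less_one[of "norm q" k]
  by (metis less_irrefl norm_ge_zero norm_one norm_power power_0_Suc power_Suc zero_less_one order_le_less)

lemma mult_q_power_neq_1:
  fixes q z :: complex
  assumes "norm q < 1" "norm z < 1"
  shows "z * q ^ k \<noteq> 1"
proof
  assume "z * q ^ k = 1"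
  moreover have "norm (z * q ^ k) \<le> norm z * 1"
    unfolding norm_mult norm_power using assms by (intro mult_left_mono power_le_one) auto
  ultimately show False using assms by simp
qed

lemma qpoch_q_nonzero: "norm q < 1 \<Longrightarrow> qpoch q q n \<noteq> 0"
  using q_power_neq_1 by (auto simp: qpoch_def)

definition qbin :: "complex \<Rightarrow> nat \<Rightarrow> nat \<Rightarrow> complex" where
  "qbin q n k = qpoch q q n / (qpoch q q k * qpoch q q (n - k))"

lemma qbin_n_0: "norm q < 1 \<Longrightarrow> qbin q n 0 = 1"
  using qpoch_q_nonzero[of q n] by (simp add: qbin_def)

lemma qbin_n_n: "norm q < 1 \<Longrightarrow> qbin q n n = 1"
  using qpoch_q_nonzero[of q n] by (simp add: qbin_def)

text \<open>
  Neighbouring Gaussian binomial coefficients as polynomial multiples of one number, so that the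
  telescoping identities become polynomial identities.
\<close>

lemma qbin_common_factor:
  assumes "norm q < 1" "k = Suc (i + r)"
  obtains g where "qbin q k i = g * (1 - q * q ^ i)" "qbin q k (Suc i) = g * (1 - q * q ^ r)"
    "qbin q (Suc k) (Suc i) = g * (1 - q * q ^ k)"
proof
  note nz = qpoch_q_nonzero[OF assms(1)] q_power_neq_1[OF assms(1)]
  show "qbin q k i = qpoch q q k / (qpoch q q (Suc i) * qpoch q q (Suc r)) * (1 - q * q ^ i)"
     "qbin q k (Suc i) = qpoch q q k / (qpoch q q (Suc i) * qpoch q q (Suc r)) * (1 - q * q ^ r)"
     "qbin q (Suc k) (Suc i) = qpoch q q k / (qpoch q q (Suc i) * qpoch q q (Suc r)) * (1 - q * q ^ k)"
    using nz(2)[of i] nz(2)[of r] nz(2)[of k] nz(1)[of i] nz(1)[of r]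
    by (simp_all add: qbin_def assms(2) qpoch_Suc Suc_diff_le del: power_Suc mult_eq_0_iff)
qed

lemma qbin_trinomial:
  assumes "norm q < 1" "n = j + M" "i \<le> M"
  shows "qbin q n (j + i) * qbin q (j + i) j = qbin q n j * qbin q M i"
  using qpoch_q_nonzero[OF assms(1)] assms(2,3) by (simp add: qbin_def)

lemma choose_two_Suc: "Suc n choose 2 = n + (n choose 2)"
  by (simp add: numeral_2_eq_2)

lemma choose_two_add: "(i + j) choose 2 = (i choose 2) + (j choose 2) + i * j"
  by (induction j) (simp_all add: choose_two_Suc)

lemma choose_two_square: "(Suc j choose 2) + (j choose 2) = j * j"
  by (induction j) (simp_all add: choose_two_Suc)

lemma prod_power_lessThan: "(\<Prod>i<j. q ^ i) = (q::complex) ^ (j choose 2)"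
  by (induction j) (simp_all add: choose_two_Suc power_add mult_ac binomial_eq_0)

text \<open>
  Reading the factors in the opposite order replaces \<open>q\<^sup>-\<^sup>1\<close> by \<open>q\<close>. This is how factorials
  such as \<open>(q\<^sup>-\<^sup>n;q)\<^sub>j\<close> are turned into ordinary ones.
\<close>

lemma qdiff_reverse:
  assumes "q \<noteq> 0" "j \<le> n"
  shows "qdiff (v * z * q ^ n / q) v q j = (- v) ^ j * q ^ (j choose 2) * qpoch (z * q ^ (n - j)) q j"
proof -
  have "qdiff (v * z * q ^ n / q) v q j = (\<Prod>i<j. (- v) * q ^ i * (1 - z * q ^ (n - Suc i)))"
    unfolding qdiff_def
  proof (rule prod.cong, goal_cases)
    case (2 i)
    then obtain m where "n = Suc (i + m)"
      using assms by (metis lessThan_iff less_le_trans less_natE)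
    then show ?case using assms by (simp add: power_add algebra_simps)
  qed simp
  also have "\<dots> = (- v) ^ j * q ^ (j choose 2) * (\<Prod>i<j. 1 - z * q ^ (n - Suc i))"
    unfolding prod.distrib by (simp add: prod_power_lessThan)
  also have "(\<Prod>i<j. 1 - z * q ^ (n - Suc i)) = qpoch (z * q ^ (n - j)) q j"
    unfolding qpoch_def using assms
    by (subst prod.nat_diff_reindex[symmetric])
       (auto intro!: prod.cong simp: mult.assoc simp flip: power_add)
  finally show ?thesis .
qed

lemma qpoch_neg_power:
  assumes q: "norm q < 1" "q \<noteq> 0" and "k \<le> n"
  shows "qpoch (q powi (- int n)) q k / qpoch q q k * q ^ k
       = qbin q n k * ((-1) ^ k * q ^ (Suc k choose 2) / q ^ (n * k))"
proof -
  have "qpoch (q powi (- int n)) q k = (- (1 / q ^ n)) ^ k * q ^ (k choose 2) * qpoch (q * q ^ (n - k)) q k"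
    using qdiff_reverse[OF q(2) \<open>k \<le> n\<close>, of "1 / q ^ n" q] q
    by (simp add: qpoch_eq_qdiff power_int_minus divide_simps)
  also have "qpoch (q * q ^ (n - k)) q k = qpoch q q n / qpoch q q (n - k)"
    using qpoch_add[of q q "n - k" k] \<open>k \<le> n\<close> qpoch_q_nonzero[OF q(1)] by simp
  finally have "qpoch (q powi (- int n)) q k
      = (- (1 / q ^ n)) ^ k * q ^ (k choose 2) * (qpoch q q n / qpoch q q (n - k))" .
  moreover have "(q ^ n) ^ k = (q ^ k) ^ n"
    by (metis power_mult mult.commute)
  ultimately show ?thesis
    using q by (simp add: qbin_def choose_two_Suc power_add power_mult power_divide
        power_minus[of "1 / q ^ n"] field_simps)
qed

lemma qpoch_neg_power_eq_0:
  assumes "q \<noteq> 0" "n < k"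
  shows "qpoch (q powi (- int n)) q k = 0"
  using assms by (auto simp: qpoch_def power_int_minus intro!: bexI[of _ n])

section \<open>The q-Saalschuetz sum\<close>

lemma sum_from_telescope:
  fixes f g :: "nat \<Rightarrow> complex"
  assumes "(\<Sum>j\<le>k. f j - c * g j) = - f (Suc k)" "(\<Sum>j\<le>k. g j) = s"
  shows "(\<Sum>j\<le>Suc k. f j) = s * c"
  using assms by (simp add: sum_subtractf algebra_simps flip: sum_distrib_left)

text \<open>
  The partial sums that make the \<open>q\<close>-Saalschuetz sum telescope. The factor
  \<open>(w\<^sub>0 - x q\<^sup>k)(1 - w\<^sub>1 y q\<^sup>k)\<close> is the quotient of the right-hand sides of \<open>q_saalschuetz\<close> for
  \<open>k + 1\<close> and \<open>k\<close>. At \<open>i = k\<close> the right-hand side is minus the summand \<open>j = k + 1\<close> that is missing on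
  the left.
\<close>

lemma q_saalschuetz_partial:
  fixes q w0 w1 x y :: complex
  assumes q: "norm q < 1" and "i \<le> k"
  defines "T \<equiv> (\<lambda>k j. qbin q k j * qdiff w1 x q j * qpoch (w0 * y) q j
                  * qpoch (x * y * q ^ j) q (k - j) * qdiff w0 w1 q (k - j))"
  shows "(\<Sum>j\<le>i. T (Suc k) j - (w0 - x * q ^ k) * (1 - w1 * y * q ^ k) * T k j)
       = - (q ^ (k - i) * qbin q k i * qdiff w1 x q (Suc i) * qpoch (w0 * y) q (Suc i)
            * qpoch (x * y * q ^ i) q (k - i) * qdiff w0 w1 q (k - i))"
  using \<open>i \<le> k\<close>
proof (induction i)
  case 0
  show ?case
    using q by (simp add: T_def qbin_n_0 qpoch_Suc qdiff_Suc) algebra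
next
  case (Suc i)
  then obtain r where k: "k = Suc (i + r)"
    by (metis less_natE Suc_le_lessD)
  obtain g where g: "qbin q k i = g * (1 - q * q ^ i)" "qbin q k (Suc i) = g * (1 - q * q ^ r)"
    "qbin q (Suc k) (Suc i) = g * (1 - q * q ^ k)"
    using qbin_common_factor[OF q k] by blast
  have d: "k - i = Suc r" "k - Suc i = r" "Suc k - Suc i = Suc r"
    using k by auto
  have e: "qpoch (x * y * q ^ Suc i) q (Suc r) = qpoch (x * y * q ^ Suc i) q r * (1 - x * y * q ^ k)"
    "qpoch (x * y * q ^ i) q (Suc r) = (1 - x * y * q ^ i) * qpoch (x * y * q ^ Suc i) q r"
    by (simp add: qpoch_Suc k power_add mult_ac) (simp add: qpoch_Suc_left mult_ac)
  have pk: "q ^ k = q * q ^ i * q ^ r"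
    by (simp add: k power_add)
  have key: "(\<Sum>j\<le>Suc i. T (Suc k) j - (w0 - x * q ^ k) * (1 - w1 * y * q ^ k) * T k j)
     = - (q ^ (Suc r) * qbin q k i * qdiff w1 x q (Suc i) * qpoch (w0 * y) q (Suc i)
            * qpoch (x * y * q ^ i) q (Suc r) * qdiff w0 w1 q (Suc r))
       + (T (Suc k) (Suc i) - (w0 - x * q ^ k) * (1 - w1 * y * q ^ k) * T k (Suc i))"
    using Suc k by (simp add: d)
  show ?case
    unfolding key unfolding T_def d g e
    unfolding pk qdiff_Suc[of _ _ _ r] qdiff_Suc[of _ _ _ "Suc i"]
      qpoch_Suc[of _ _ "Suc i"] power_Suc
    by algebra
qed

text \<open>
  The \<open>q\<close>-Saalschuetz sum for a balanced terminating \<open>\<^sub>3\<phi>\<^sub>2\<close>. With \<open>w = w\<^sub>1/w\<^sub>0\<close>,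
  \<open>X = x/w\<^sub>1\<close> and \<open>Y = w\<^sub>0y\<close>, it is the usual evaluation of
  \<open>\<^sub>3\<phi>\<^sub>2(q\<^sup>-\<^sup>k, X, Y; wXY, q\<^sup>1\<^sup>-\<^sup>k/w; q, q)\<close>. Keeping both \<open>w\<^sub>0\<close> and \<open>w\<^sub>1\<close>
  allows either of them to be \<open>0\<close>; the Sears transformation uses it once with \<open>w\<^sub>0 = 1\<close> and once with
  \<open>w\<^sub>1 = 1\<close>.
\<close>

lemma q_saalschuetz:
  fixes q w0 w1 x y :: complex
  assumes q: "norm q < 1"
  shows "(\<Sum>j\<le>k. qbin q k j * qdiff w1 x q j * qpoch (w0 * y) q j
                  * qpoch (x * y * q ^ j) q (k - j) * qdiff w0 w1 q (k - j))
         = qdiff w0 x q k * qpoch (w1 * y) q k"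
proof (induction k)
  case 0
  show ?case by (simp add: qbin_def)
next
  case (Suc k)
  have "qdiff w0 x q (Suc k) * qpoch (w1 * y) q (Suc k)
      = qdiff w0 x q k * qpoch (w1 * y) q k * ((w0 - x * q ^ k) * (1 - w1 * y * q ^ k))"
    by (simp add: qdiff_Suc qpoch_Suc)
  then show ?case
    using sum_from_telescope[OF _ Suc] q_saalschuetz_partial[OF q, of k k w1 x w0 y] q
    by (simp add: qbin_n_n del: sum.atMost_Suc)
qed

text \<open>
  The \<open>q\<close>-Saalschuetz sum with \<open>w\<^sub>1 = 1\<close> and \<open>w\<^sub>0 = s q\<^sup>M\<^sup>-\<^sup>1\<close>, rewritten in the form in which it
  appears as the inner sum in the Sears transformation.
\<close>

lemma q_saalschuetz_reversed:
  assumes q: "norm q < 1" "q \<noteq> 0" and Z: "Z \<noteq> 0"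
  shows "(\<Sum>i\<le>M. qbin q M i * ((-1) ^ i * q ^ (Suc i choose 2) / q ^ (M * i)) * qpoch Z q i
            * qpoch (p * s * q ^ M / (q * Z)) q i * qpoch (p * q ^ i) q (M - i) * qpoch (s * q ^ i) q (M - i))
       = Z ^ M * qpoch (p / Z) q M * qpoch (s / Z) q M"
proof -
  define c where "c = (- 1) ^ M * q ^ (M choose 2)"
  have c0: "c \<noteq> 0" using q by (simp add: c_def)
  have "(\<Sum>i\<le>M. c * (qbin q M i * ((-1) ^ i * q ^ (Suc i choose 2) / q ^ (M * i)) * qpoch Z q i
            * qpoch (p * s * q ^ M / (q * Z)) q i * qpoch (p * q ^ i) q (M - i) * qpoch (s * q ^ i) q (M - i)))
     = (\<Sum>i\<le>M. qbin q M i * qdiff 1 Z q i * qpoch (s * q ^ M / q * (p / Z)) q i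
            * qpoch (Z * (p / Z) * q ^ i) q (M - i) * qdiff (s * q ^ M / q) 1 q (M - i))"
  proof (rule sum.cong, goal_cases)
    case (2 i)
    then obtain r where M: "M = i + r"
      using le_Suc_ex by auto
    have e: "(M choose 2) + (Suc i choose 2) = (r choose 2) + M * i"
      using choose_two_square[of i] by (simp add: M choose_two_add algebra_simps)
    have e1: "q ^ (M choose 2) * (q ^ (Suc i choose 2) / q ^ (M * i)) = q ^ (r choose 2)"
      using q arg_cong[OF e, of "power q"] by (simp add: power_add field_simps)
    have e2: "qdiff (s * q ^ M / q) 1 q r = (- 1) ^ r * q ^ (r choose 2) * qpoch (s * q ^ i) q r"
      using qdiff_reverse[of q r M 1 s] q M by simp
    have e3: "c * (- 1) ^ i = (- 1) ^ r * q ^ (M choose 2)"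
      by (simp add: c_def M power_add flip: power_mult_distrib)
    have e4: "c * ((-1) ^ i * q ^ (Suc i choose 2) / q ^ (M * i)) * qpoch (s * q ^ i) q r
      = qdiff (s * q ^ M / q) 1 q r"
    proof -
      have e4: "c * ((-1) ^ i * q ^ (Suc i choose 2) / q ^ (M * i)) * qpoch (s * q ^ i) q r
        = (c * (- 1) ^ i) * (q ^ (Suc i choose 2) / q ^ (M * i)) * qpoch (s * q ^ i) q r"
        by simp
      then show ?thesis
        unfolding e2 e3 e1[symmetric] by simp
    qed
    have e5: "M - i = r" "Z * (p / Z) = p" "s * q ^ M / q * (p / Z) = p * s * q ^ M / (q * Z)"
      using M Z by simp_all
    show ?case
      unfolding e5 e4[symmetric] qpoch_eq_qdiff[of Z] by (simp only: mult_ac times_divide_eq_right times_divide_eq_left)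
  qed simp
  also have "\<dots> = qdiff (s * q ^ M / q) Z q M * qpoch (p / Z) q M"
    using q_saalschuetz[OF q(1), where ?w0.0 = "s * q ^ M / q" and ?w1.0 = 1 and x = Z and y = "p / Z" and k = M]
    by simp
  also have "qdiff (s * q ^ M / q) Z q M = c * (Z ^ M * qpoch (s / Z) q M)"
    using qdiff_reverse[of q M M Z "s / Z"] q Z by (simp add: c_def power_minus')
  also have "c * (Z ^ M * qpoch (s / Z) q M) * qpoch (p / Z) q M
      = c * (Z ^ M * qpoch (p / Z) q M * qpoch (s / Z) q M)"
    by (simp only: mult_ac)
  finally show ?thesis
    unfolding sum_distrib_left[symmetric] mult_left_cancel[OF c0] .
qed

section \<open>The terminating very-well-poised sum\<close>

text \<open>
  The partial sums that make the \<open>\<^sub>6\<phi>\<^sub>5\<close> sum telescope, organised as for \<open>q_saalschuetz_partial\<close>: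
  \<open>q\<^sup>M\<^sup>+\<^sup>1 - B\<kappa>\<close> is the quotient of the right-hand sides of \<open>very_well_poised_sum\<close> for \<open>M + 1\<close> and \<open>M\<close>.
\<close>

lemma very_well_poised_partial:
  fixes q A B \<kappa> :: complex
  assumes q: "norm q < 1" and nz: "\<And>k. A * q ^ k \<noteq> 1" and "i \<le> M"
  defines "T \<equiv> (\<lambda>M m. qbin q M m * (1 - A * q ^ (2 * m)) / qpoch (A * q ^ m) q (Suc M)
             * qpoch B q m * qpoch (A * \<kappa>) q m
             * (\<Prod>l\<in>{m..<M}. (q * q ^ l - \<kappa>) * (B - A * q * q ^ l)) * q ^ (Suc m choose 2))"
  shows "(\<Sum>m\<le>i. T (Suc M) m - (q * q ^ M - B * \<kappa>) * T M m)
       = - (qbin q M i * qpoch B q (Suc i) * qpoch (A * \<kappa>) q (Suc i)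
            * (\<Prod>l\<in>{i..<M}. (q * q ^ l - \<kappa>) * (B - A * q * q ^ l))
            * q ^ (Suc (Suc i) choose 2) * q ^ (M - i) / qpoch (A * q ^ Suc i) q (Suc M))"
  using \<open>i \<le> M\<close>
proof (induction i)
  case 0
  define K where "K = (\<Prod>l\<in>{0..<M}. (q * q ^ l - \<kappa>) * (B - A * q * q ^ l)) /
      (qpoch (A * q) q M * (1 - A * q * q ^ M))"
  note nzs = nz[of 0] nz[of "Suc 0"] nz[of "Suc M"]
  have D: "qpoch (A * q) q M \<noteq> 0"
    using nz[of "Suc _"] by (auto simp: qpoch_def mult_ac)
  have t1: "T (Suc M) 0 = K * ((q * q ^ M - \<kappa>) * (B - A * q * q ^ M))"
    and t2: "T M 0 = K * (1 - A * q * q ^ M)"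
    using nzs D q
    by (simp_all add: T_def K_def qbin_n_0 qpoch_Suc_left[of A] qpoch_Suc[of "A * q"] mult_ac numeral_2_eq_2)
  have t3: "qbin q M 0 * qpoch B q (Suc 0) * qpoch (A * \<kappa>) q (Suc 0)
            * (\<Prod>l\<in>{0..<M}. (q * q ^ l - \<kappa>) * (B - A * q * q ^ l))
            * q ^ (Suc (Suc 0) choose 2) * q ^ (M - 0) / qpoch (A * q ^ Suc 0) q (Suc M)
       = K * ((1 - B) * (1 - A * \<kappa>) * q * q ^ M)"
    using q by (simp add: K_def qbin_n_0 qpoch_Suc mult_ac numeral_2_eq_2)
  show ?case
    unfolding t3 by (simp add: t1 t2 algebra_simps)
next
  case (Suc i)
  then obtain r where M: "M = Suc (i + r)"
    by (metis less_natE Suc_le_lessD)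
  obtain g where g: "qbin q M i = g * (1 - q * q ^ i)" "qbin q M (Suc i) = g * (1 - q * q ^ r)"
    "qbin q (Suc M) (Suc i) = g * (1 - q * q ^ M)"
    using qbin_common_factor[OF q M] by blast
  define f where "f = (\<lambda>l. (q * q ^ l - \<kappa>) * (B - A * q * q ^ l))"
  define D where "D = qpoch (A * q ^ Suc (Suc i)) q M"
  define v where "v = A * q ^ (i + M + 2)"
  \<comment> \<open>the common factor of the four terms of the induction step\<close>
  define K where "K = g * qpoch B q (Suc i) * qpoch (A * \<kappa>) q (Suc i) * q ^ (Suc (Suc i) choose 2)
      * (\<Prod>l\<in>{Suc i..<M}. f l) / ((1 - A * q ^ Suc i) * D * (1 - v))"
  have D0: "D \<noteq> 0"
    unfolding D_def qpoch_def using nz[of "Suc (Suc i) + _"] by (auto simp: power_add mult_ac)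
  note nzs = nz[of "Suc i"] nz[of "i + M + 2", folded v_def]
  have sv: "A * q ^ Suc i * q = A * q ^ Suc (Suc i)" "A * q ^ Suc (Suc i) * q ^ M = v"
    by (simp_all add: v_def power_add mult_ac power2_eq_square)
  have e: "qpoch (A * q ^ Suc i) q (Suc (Suc M)) = (1 - A * q ^ Suc i) * D * (1 - v)"
    "qpoch (A * q ^ Suc i) q (Suc M) = (1 - A * q ^ Suc i) * D"
    "qpoch (A * q ^ Suc (Suc i)) q (Suc M) = D * (1 - v)"
    unfolding qpoch_Suc_left[of "A * q ^ Suc i"] sv qpoch_Suc[of "A * q ^ Suc (Suc i)"]
      D_def[symmetric]
    by (simp_all only: mult.assoc)
  have pf: "(\<Prod>l\<in>{Suc i..<Suc M}. f l) = f M * (\<Prod>l\<in>{Suc i..<M}. f l)"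
    "(\<Prod>l\<in>{i..<M}. f l) = f i * (\<Prod>l\<in>{Suc i..<M}. f l)"
    using M by (simp_all add: prod.atLeastLessThan_Suc mult.commute prod.atLeast_Suc_lessThan)
  have c: "Suc (Suc (Suc i)) choose 2 = (Suc (Suc i) choose 2) + Suc (Suc i)"
    by (simp add: numeral_2_eq_2)
  have t1: "T (Suc M) (Suc i) = K * ((1 - q * q ^ M) * (1 - A * q ^ (2 * Suc i)) * f M)"
    unfolding T_def f_def[symmetric] pf g e K_def by simp
  have t2: "T M (Suc i) = K * ((1 - q * q ^ r) * (1 - A * q ^ (2 * Suc i)) * (1 - v))"
    unfolding T_def f_def[symmetric] pf g e K_def using nzs by simp
  have t3: "(\<Sum>m\<le>i. T (Suc M) m - (q * q ^ M - B * \<kappa>) * T M m)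
    = - (K * ((1 - q * q ^ i) * (q * q ^ r) * f i * (1 - v)))"
  proof -
    have "M - i = Suc r" using M by simp
    then show ?thesis
    using Suc nzs unfolding f_def[symmetric] pf g e K_def by simp
  qed
  have t4: "qbin q M (Suc i) * qpoch B q (Suc (Suc i)) * qpoch (A * \<kappa>) q (Suc (Suc i))
            * (\<Prod>l\<in>{Suc i..<M}. f l)
            * q ^ (Suc (Suc (Suc i)) choose 2) * q ^ (M - Suc i) / qpoch (A * q ^ Suc (Suc i)) q (Suc M)
    = K * ((1 - q * q ^ r) * (1 - B * q ^ Suc i) * (1 - A * \<kappa> * q ^ Suc i) * q ^ Suc (Suc i)
           * q ^ r * (1 - A * q ^ Suc i))"
  proof -
    have "M - Suc i = r" using M by simp
    then show ?thesis
      unfolding c qpoch_Suc[of _ _ "Suc i"] power_add g e K_def using nzs by (simp add: mult_ac)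
  qed
  have p: "q ^ M = q * q ^ i * q ^ r" "v = A * q ^ 3 * (q ^ i)\<^sup>2 * q ^ r"
    by (simp_all add: v_def M power_add power2_eq_square power3_eq_cube mult_ac)
  have p': "q ^ (2 * Suc i) = (q * q ^ i)\<^sup>2"
    by (metis power_Suc power_even_eq)
  show ?case
    unfolding sum.atMost_Suc t1 t2 t3 f_def[symmetric] t4
    unfolding f_def p p' power_Suc
    by algebra
qed

text \<open>
  The sum of the terminating very-well-poised \<open>\<^sub>6\<phi>\<^sub>5\<close> with base \<open>A\<close> and free parameters \<open>B\<close> and
  \<open>C = A\<kappa>\<close>. The usual form divides by \<open>B\<close> and by \<open>C\<close>. Writing \<open>C = A\<kappa>\<close> allows a common factor \<open>A\<^sup>M\<close>
  to be cancelled, so that the identity also covers \<open>A = 0\<close>.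
\<close>

lemma very_well_poised_sum:
  fixes q A B \<kappa> :: complex
  assumes q: "norm q < 1" and nz: "\<And>k. A * q ^ k \<noteq> 1"
  shows "(\<Sum>m\<le>M. qbin q M m * (1 - A * q ^ (2 * m)) / qpoch (A * q ^ m) q (Suc M)
             * qpoch B q m * qpoch (A * \<kappa>) q m
             * (\<Prod>l\<in>{m..<M}. (q * q ^ l - \<kappa>) * (B - A * q * q ^ l)) * q ^ (Suc m choose 2))
         = (\<Prod>l<M. q * q ^ l - B * \<kappa>)"
proof (induction M)
  case 0
  show ?case using nz[of 0] by (simp add: qbin_def qpoch_Suc numeral_2_eq_2)
next
  case (Suc M)
  have "qpoch (A * q ^ Suc M) q (Suc (Suc M))
     = qpoch (A * q ^ Suc M) q (Suc M) * (1 - A * q ^ (2 * Suc M))"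
    by (subst qpoch_Suc) (simp add: mult.assoc mult_2 flip: power_add)
  moreover have "A * q ^ (2 * Suc M) \<noteq> 1" by (rule nz)
  ultimately show ?case
    using sum_from_telescope[OF _ Suc] very_well_poised_partial[OF q nz, of M M B \<kappa>] q
    by (simp add: qbin_n_n del: sum.atMost_Suc power_Suc mult_Suc_right)
qed

text \<open>
  The very-well-poised sum with \<open>\<kappa> = (a/\<alpha>) q\<^sup>M\<close> and \<open>B = \<alpha>\<beta>\<close>, the specialisation that arises when
  coefficients are compared in the connection formula; \<open>D = Aq/B\<close> is the parameter paired
  with \<open>B\<close>.
\<close>

lemma very_well_poised_sum_connection:
  fixes q A D \<alpha> \<beta> a :: complex
  assumes q: "norm q < 1" "q \<noteq> 0" and nz: "\<And>k. A * q ^ k \<noteq> 1"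
    and \<alpha>: "\<alpha> \<noteq> 0" and D: "\<alpha> * \<beta> * D = A * q"
  shows "(\<Sum>m\<le>M. qbin q M m * (1 - A * q ^ (2 * m)) / qpoch (A * q ^ m) q (Suc M)
             * qpoch (\<alpha> * \<beta>) q m * qpoch (A * (a / \<alpha> * q ^ M)) q m
             * qdiff \<alpha> a q (M - m) * qpoch (D * q ^ m) q (M - m) * \<beta> ^ (M - m))
         = qpoch (a * \<beta>) q M"
proof -
  \<comment> \<open>the power of \<open>q\<close> by which this form differs from \<open>very_well_poised_sum\<close>\<close>
  define c where "c = q ^ (Suc M choose 2)"
  have c0: "c \<noteq> 0" using q by (simp add: c_def)
  have f: "(\<Prod>l\<in>{m..<M}. (q * q ^ l - a / \<alpha> * q ^ M) * (\<alpha> * \<beta> - A * q * q ^ l)) * q ^ (Suc m choose 2)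
      = c * (qdiff \<alpha> a q (M - m) * qpoch (D * q ^ m) q (M - m) * \<beta> ^ (M - m))" if "m \<le> M" for m
  proof -
    obtain r where M: "M = m + r" using \<open>m \<le> M\<close> le_Suc_ex by auto
    have "(\<Prod>l\<in>{m..<M}. (q * q ^ l - a / \<alpha> * q ^ M) * (\<alpha> * \<beta> - A * q * q ^ l))
      = (\<Prod>i<r. (q * q ^ (m + i) - a / \<alpha> * q ^ M) * (\<alpha> * \<beta> - A * q * q ^ (m + i)))"
      unfolding M by (rule prod.reindex_bij_witness[where i = "\<lambda>i. m + i" and j = "\<lambda>l. l - m"]) auto
    also have "\<dots> = (\<Prod>i<r. (q ^ Suc m * q ^ i) * (\<alpha> - a * q ^ (r - Suc i)) * (1 - (D * q ^ m) * q ^ i) * \<beta>)"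
    proof (rule prod.cong, goal_cases)
      case (2 i)
      then obtain t where r: "r = Suc (i + t)"
        by (metis lessThan_iff less_natE)
      show ?case unfolding D[symmetric] M r using \<alpha> by (simp add: power_add field_simps)
    qed simp
    also have "\<dots> = (q ^ Suc m) ^ r * q ^ (r choose 2) * (\<Prod>i<r. \<alpha> - a * q ^ (r - Suc i))
        * qpoch (D * q ^ m) q r * \<beta> ^ r"
      unfolding prod.distrib by (simp add: prod_power_lessThan qpoch_def)
    also have "(\<Prod>i<r. \<alpha> - a * q ^ (r - Suc i)) = qdiff \<alpha> a q r"
      unfolding qdiff_def by (rule prod.nat_diff_reindex)
    finally have 1: "(\<Prod>l\<in>{m..<M}. (q * q ^ l - a / \<alpha> * q ^ M) * (\<alpha> * \<beta> - A * q * q ^ l))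
       = (q ^ Suc m) ^ r * q ^ (r choose 2) * qdiff \<alpha> a q r * qpoch (D * q ^ m) q r * \<beta> ^ r" .
    have "Suc m * r + (r choose 2) + (Suc m choose 2) = (Suc M choose 2)"
      by (simp add: M choose_two_Suc choose_two_add algebra_simps)
    then have 2: "(q ^ Suc m) ^ r * q ^ (r choose 2) * q ^ (Suc m choose 2) = c"
      unfolding c_def by (simp only: power_mult[symmetric] power_add[symmetric])
    show ?thesis
      unfolding 1 2[symmetric] by (simp add: M)
  qed
  have g: "(\<Prod>l<M. q * q ^ l - (\<alpha> * \<beta>) * (a / \<alpha> * q ^ M)) = c * qpoch (a * \<beta>) q M"
  proof -
    have "(\<Prod>l<M. q * q ^ l - (\<alpha> * \<beta>) * (a / \<alpha> * q ^ M)) = (\<Prod>l<M. q * q ^ l * (1 - a * \<beta> * q ^ (M - Suc l)))"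
    proof (rule prod.cong, goal_cases)
      case (2 i)
      then obtain t where M: "M = Suc (i + t)"
        by (metis lessThan_iff less_natE)
      show ?case unfolding M using \<alpha> by (simp add: power_add field_simps)
    qed simp
    also have "\<dots> = q ^ M * q ^ (M choose 2) * (\<Prod>i<M. 1 - a * \<beta> * q ^ (M - Suc i))"
      unfolding prod.distrib by (simp add: prod_power_lessThan)
    also have "(\<Prod>i<M. 1 - a * \<beta> * q ^ (M - Suc i)) = qpoch (a * \<beta>) q M"
      unfolding qpoch_def by (rule prod.nat_diff_reindex)
    finally show ?thesis by (simp add: c_def choose_two_Suc power_add)
  qed
  have "c * (\<Sum>m\<le>M. qbin q M m * (1 - A * q ^ (2 * m)) / qpoch (A * q ^ m) q (Suc M)
             * qpoch (\<alpha> * \<beta>) q m * qpoch (A * (a / \<alpha> * q ^ M)) q m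
             * qdiff \<alpha> a q (M - m) * qpoch (D * q ^ m) q (M - m) * \<beta> ^ (M - m))
     = (\<Sum>m\<le>M. qbin q M m * (1 - A * q ^ (2 * m)) / qpoch (A * q ^ m) q (Suc M)
             * qpoch (\<alpha> * \<beta>) q m * qpoch (A * (a / \<alpha> * q ^ M)) q m
             * (\<Prod>l\<in>{m..<M}. (q * q ^ l - a / \<alpha> * q ^ M) * (\<alpha> * \<beta> - A * q * q ^ l)) * q ^ (Suc m choose 2))"
    unfolding sum_distrib_left
  proof (rule sum.cong, goal_cases)
    case (2 m)
    then have "m \<le> M" by simp
    show ?case
      unfolding mult.assoc[of _ "\<Prod>l\<in>{m..<M}. (q * q ^ l - a / \<alpha> * q ^ M) * (\<alpha> * \<beta> - A * q * q ^ l)"]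
        f[OF \<open>m \<le> M\<close>]
      by (simp only: mult_ac)
  qed simp
  also have "\<dots> = c * qpoch (a * \<beta>) q M"
    by (simp only: very_well_poised_sum[OF q(1) nz] g)
  finally show ?thesis using c0 by simp
qed

section \<open>Askey--Wilson polynomials and the Sears transformation\<close>

text \<open>
  The coefficient of \<open>t\<^sup>n\<close> in the product of the two \<open>\<^sub>2\<phi>\<^sub>1\<close> series, multiplied by \<open>(q,ab,cd;q)\<^sub>n\<close>.
  The multiplication clears all denominators that depend on the parameters.
\<close>

definition aw_sum :: "nat \<Rightarrow> complex \<Rightarrow> complex \<Rightarrow> complex \<Rightarrow> complex \<Rightarrow> complex \<Rightarrow> complex \<Rightarrow> complex" where
  "aw_sum n a b c d E q = (\<Sum>k\<le>n. qbin q n k * qpoch (a * b * q ^ k) q (n - k) * qpoch (c * d * q ^ (n - k)) q k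
     * qpoch (a * E) q k * qpoch (b * E) q k * qpoch (c / E) q (n - k) * qpoch (d / E) q (n - k)
     * E ^ (n - k) / E ^ k)"

lemma aw_sum_commute: "aw_sum n a b c d E q = aw_sum n b a c d E q"
  by (simp add: aw_sum_def mult_ac)

lemma sum_triangle:
  fixes g :: "nat \<Rightarrow> nat \<Rightarrow> complex"
  shows "(\<Sum>k\<le>n. \<Sum>j\<le>k. g k j) = (\<Sum>j\<le>n. \<Sum>i\<le>n - j. g (j + i) j)"
  unfolding sum.Sigma[OF finite_atMost ballI[OF finite_atMost]]
  by (rule sum.reindex_bij_witness[where i = "\<lambda>(j, i). (j + i, j)" and j = "\<lambda>(k, j). (j, k - j)"]) auto

text \<open>
  The right-hand side is a \<open>\<^sub>4\<phi>\<^sub>3\<close> like the left-hand side, and the identity is the Sears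
  transformation between them. Expand \<open>(a/E, abcdq\<^sup>n\<^sup>-\<^sup>1;q)\<^sub>k\<close> by the \<open>q\<close>-Saalschuetz sum; after
  exchanging the summations, the inner sum is again a balanced \<open>\<^sub>3\<phi>\<^sub>2\<close>.
\<close>

lemma aw_sum_sears:
  assumes q: "norm q < 1" "q \<noteq> 0" and a: "a \<noteq> 0" and E: "E \<noteq> 0"
  shows "(\<Sum>k\<le>n. qbin q n k * ((-1) ^ k * q ^ (Suc k choose 2) / q ^ (n * k))
            * qpoch (a * b * q ^ k) q (n - k) * qpoch (a * c * q ^ k) q (n - k) * qpoch (a * d * q ^ k) q (n - k)
            * qpoch (a * b * c * d * q ^ n / q) q k * qpoch (a * E) q k * qpoch (a / E) q k)
        = a ^ n * aw_sum n a b c d E q" (is "?L = _")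
proof -
  define s where "s = (\<lambda>n k. (-1) ^ k * q ^ (Suc k choose 2) / q ^ (n * k))"
  \<comment> \<open>the parameter \<open>w\<^sub>1\<close> for which \<open>w\<^sub>1 y = abcdq\<^sup>n\<^sup>-\<^sup>1\<close> and \<open>x y = ab\<close>, with \<open>x = a/E\<close> and \<open>y = bE\<close>\<close>
  define w where "w = a * c * d * q ^ n / (q * E)"
  define g where "g = (\<lambda>k j. qbin q n k * s n k
     * qpoch (a * b * q ^ k) q (n - k) * qpoch (a * c * q ^ k) q (n - k) * qpoch (a * d * q ^ k) q (n - k)
     * qpoch (a * E) q k * (qbin q k j * qdiff w (a / E) q j * qpoch (b * E) q j
                  * qpoch (a * b * q ^ j) q (k - j) * qpoch w q (k - j)))"
  have ex: "qpoch (a / E) q k * qpoch (a * b * c * d * q ^ n / q) q k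
      = (\<Sum>j\<le>k. qbin q k j * qdiff w (a / E) q j * qpoch (b * E) q j
                  * qpoch (a * b * q ^ j) q (k - j) * qpoch w q (k - j))" for k
    using q_saalschuetz[OF q(1), where ?w0.0 = 1 and ?w1.0 = w and x = "a / E" and y = "b * E" and k = k] E
    by (simp add: qpoch_eq_qdiff w_def mult_ac)
  have "?L = (\<Sum>k\<le>n. \<Sum>j\<le>k. g k j)"
    unfolding g_def s_def sum_distrib_left[symmetric] ex[symmetric] by (simp only: mult_ac)
  also have "\<dots> = (\<Sum>j\<le>n. \<Sum>i\<le>n - j. g (j + i) j)"
    by (rule sum_triangle)
  also have "\<dots> = (\<Sum>j\<le>n. a ^ n * (qbin q n j * qpoch (a * b * q ^ j) q (n - j) * qpoch (c * d * q ^ (n - j)) q j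
     * qpoch (a * E) q j * qpoch (b * E) q j * qpoch (c / E) q (n - j) * qpoch (d / E) q (n - j)
     * E ^ (n - j) / E ^ j))"
  proof (rule sum.cong, goal_cases)
    case (2 j)
    then obtain M where n: "n = j + M"
      using le_Suc_ex by auto
    \<comment> \<open>the inner sum over \<open>i = k - j\<close> is \<open>q_saalschuetz_reversed\<close> with \<open>p = acq\<^sup>j\<close> and \<open>s = adq\<^sup>j\<close>\<close>
    define Z where "Z = a * E * q ^ j"
    define h where "h = (\<lambda>i. qbin q M i * s M i * qpoch Z q i
            * qpoch ((a * c * q ^ j) * (a * d * q ^ j) * q ^ M / (q * Z)) q i
            * qpoch (a * c * q ^ j * q ^ i) q (M - i) * qpoch (a * d * q ^ j * q ^ i) q (M - i))"
    define C where "C = qbin q n j * s n j * qpoch (a * b * q ^ j) q M * qpoch (a * E) q j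
        * qpoch (b * E) q j * qdiff w (a / E) q j"
    have w: "(a * c * q ^ j) * (a * d * q ^ j) * q ^ M / (q * Z) = w"
      using a q E by (simp add: Z_def w_def n power_add)
    have Z0: "Z \<noteq> 0" using a q E by (simp add: Z_def)
    have g_h: "g (j + i) j = C * h i" if "i \<le> M" for i
    proof -
      obtain r where M: "M = i + r" using \<open>i \<le> M\<close> le_Suc_ex by auto
      have "(Suc (j + i) choose 2) + M * i + n * j = (Suc i choose 2) + (Suc j choose 2) + n * (j + i)"
        by (simp add: n choose_two_Suc choose_two_add algebra_simps)
      from arg_cong[OF this, of "power q"]
      have s: "s n (j + i) = s n j * s M i"
        using q by (simp add: s_def power_add field_simps)
      have ab: "qpoch (a * b * q ^ (j + i)) q r * qpoch (a * b * q ^ j) q i = qpoch (a * b * q ^ j) q M"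
        using qpoch_mult_shifted[of "a * b" q j i r] by (simp add: M mult_ac)
      have aE: "qpoch (a * E) q (j + i) = qpoch (a * E) q j * qpoch Z q i"
        by (simp add: qpoch_add Z_def)
      have r: "n - (j + i) = r" "M - i = r" "j + i - j = i" by (simp_all add: n M)
      have "g (j + i) j = (qbin q n (j + i) * qbin q (j + i) j) * s n (j + i)
         * (qpoch (a * b * q ^ (j + i)) q r * qpoch (a * b * q ^ j) q i)
         * qpoch (a * E) q (j + i) * (qpoch (a * c * q ^ (j + i)) q r * qpoch (a * d * q ^ (j + i)) q r
         * qdiff w (a / E) q j * qpoch (b * E) q j * qpoch w q i)"
        unfolding g_def r by (simp only: mult_ac)
      also have "\<dots> = C * h i"
        unfolding qbin_trinomial[OF q(1) n that] s ab aE C_def h_def w r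
        by (simp add: power_add mult_ac)
      finally show ?thesis .
    qed
    have hs: "(\<Sum>i\<le>M. h i) = Z ^ M * qpoch (c / E) q M * qpoch (d / E) q M"
      using q_saalschuetz_reversed[OF q Z0, of M "a * c * q ^ j" "a * d * q ^ j"] a E q
      unfolding h_def s_def by (simp add: Z_def)
    have wj: "qdiff w (a / E) q j = (- (a / E)) ^ j * q ^ (j choose 2) * qpoch (c * d * q ^ M) q j"
      using qdiff_reverse[of q j n "a / E" "c * d"] q n by (simp add: w_def mult_ac)
    have "(Suc j choose 2) + (j choose 2) + j * M = n * j"
      using choose_two_square[of j] by (simp add: n algebra_simps)
    note e = arg_cong[OF this, of "power q"]
    have pw: "(q ^ j) ^ M = (q ^ M) ^ j"
      by (metis power_mult mult.commute)
    have sj: "s n j * (- (a / E)) ^ j * q ^ (j choose 2) * Z ^ M = a ^ n * E ^ M / E ^ j"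
      using e q E pw by (simp add: s_def Z_def n power_add power_mult_distrib power_mult power_divide
          power_minus'[of "a / E"] field_simps)
    have "(\<Sum>i\<le>n - j. g (j + i) j) = C * (\<Sum>i\<le>M. h i)"
      by (simp add: n g_h sum_distrib_left)
    also have "\<dots> = (s n j * (- (a / E)) ^ j * q ^ (j choose 2) * Z ^ M)
       * (qbin q n j * qpoch (a * b * q ^ j) q M * qpoch (a * E) q j
        * qpoch (b * E) q j * qpoch (c * d * q ^ M) q j * qpoch (c / E) q M * qpoch (d / E) q M)"
      unfolding hs C_def wj by (simp only: mult_ac)
    also have "\<dots> = a ^ n * (qbin q n j * qpoch (a * b * q ^ j) q (n - j) * qpoch (c * d * q ^ (n - j)) q j
     * qpoch (a * E) q j * qpoch (b * E) q j * qpoch (c / E) q (n - j) * qpoch (d / E) q (n - j)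
     * E ^ (n - j) / E ^ j)"
      unfolding sj by (simp add: n)
    finally show ?case .
  qed simp
  also have "\<dots> = a ^ n * aw_sum n a b c d E q"
    by (simp add: aw_sum_def sum_distrib_left)
  finally show ?thesis .
qed

text \<open>
  The expansion in \<open>(aE,a/E;q)\<^sub>k\<close> does not change under \<open>E \<mapsto> 1/E\<close>, which the definition of
  \<open>aw_sum\<close> does not show.
\<close>

lemma aw_sum_inverse:
  assumes q: "norm q < 1" "q \<noteq> 0" and a: "a \<noteq> 0" and E: "E \<noteq> 0"
  shows "aw_sum n a b c d (1 / E) q = aw_sum n a b c d E q"
proof -
  have "a ^ n * aw_sum n a b c d (1 / E) q = a ^ n * aw_sum n a b c d E q"
    using E unfolding aw_sum_sears[OF q a E, symmetric]
    by (subst aw_sum_sears[OF q a, symmetric]) (simp_all add: mult_ac)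
  then show ?thesis using a by simp
qed

text \<open>
  The defining \<open>\<^sub>4\<phi>\<^sub>3\<close> is the expansion in \<open>(aE,a/E;q)\<^sub>k\<close> of \<open>aw_sum_sears\<close>. Since \<open>Arccos (cos \<theta>)\<close> need
  not be \<open>\<theta>\<close>, the exponential in the definition is \<open>E\<close> or \<open>1/E\<close>, and both give the same value.
\<close>

lemma askey_wilson_eq_aw_sum:
  fixes \<theta> :: real
  assumes q: "norm q < 1" "q \<noteq> 0" and a: "a \<noteq> 0"
    and nz: "\<And>k. a * b * q ^ k \<noteq> 1" "\<And>k. a * c * q ^ k \<noteq> 1" "\<And>k. a * d * q ^ k \<noteq> 1"
  shows "askey_wilson n (cos \<theta>) a b c d q = aw_sum n a b c d (exp (\<i> * \<theta>)) q"
proof -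
  define E where "E = exp (\<i> * complex_of_real \<theta>)"
  define \<phi> where "\<phi> = Arccos (complex_of_real (cos \<theta>))"
  define F where "F = exp (\<i> * \<phi>)"
  have F: "F \<noteq> 0" "exp (- \<i> * \<phi>) = 1 / F" and E: "E \<noteq> 0" "exp (- \<i> * complex_of_real \<theta>) = 1 / E"
    by (simp_all add: F_def E_def exp_minus field_simps)
  have nzs: "qpoch (a * b) q k \<noteq> 0" "qpoch (a * c) q k \<noteq> 0" "qpoch (a * d) q k \<noteq> 0" for k
    using nz by (auto simp: qpoch_def)
  have "cos \<phi> = cos (complex_of_real \<theta>)"
    by (simp add: \<phi>_def cos_Arccos cos_of_real)
  moreover have "F + 1 / F = 2 * cos \<phi>" "E + 1 / E = 2 * cos (complex_of_real \<theta>)"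
    using F(2) E(2) by (simp_all add: cos_exp_eq flip: F_def E_def)
  ultimately have FE_sum: "E + 1 / E = F + 1 / F"
    by simp
  \<comment> \<open>\<open>F\<close> is a root of \<open>z\<^sup>2 - 2 cos \<theta> z + 1\<close>, whose roots are \<open>E\<close> and \<open>1/E\<close>\<close>
  have "(F - E) * (F - G) = F * F - F * (E + G) + E * G" for G
    by (simp add: algebra_simps)
  from this[of "1 / E"] have "(F - E) * (F - 1 / E) = F * F - F * (E + 1 / E) + 1"
    unfolding nonzero_mult_div_cancel_left[OF E(1)] times_divide_eq_right mult_1_right divide_self[OF E(1)] .
  also have "\<dots> = 0"
    unfolding FE_sum distrib_left using F(1) by simp
  finally have "F = E \<or> F = 1 / E"
    by simp
  then have FE: "aw_sum n a b c d F q = aw_sum n a b c d E q"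
    using aw_sum_inverse[OF q a E(1), of n b c d] by metis
  define f where "f = (\<lambda>k. qpochs [q powi (- int n), a * b * c * d * q powi (int n - 1), a * F, a * (1 / F)] q k
      / qpochs [q, a * b, a * c, a * d] q k * q ^ k)"
  have "askey_wilson n (cos \<theta>) a b c d q
      = a powi (- int n) * (qpochs [a * b, a * c, a * d] q n * (\<Sum>k. f k))"
    unfolding askey_wilson_def basic_hypergeom_def Let_def \<phi>_def[symmetric] F(2) F_def[symmetric] f_def
    by simp
  also have "(\<Sum>k. f k) = (\<Sum>k\<le>n. f k)"
    by (rule suminf_finite) (auto simp: f_def qpochs_def qpoch_neg_power_eq_0[OF q(2)])
  also have "qpochs [a * b, a * c, a * d] q n * (\<Sum>k\<le>n. f k)
     = (\<Sum>k\<le>n. qbin q n k * ((-1) ^ k * q ^ (Suc k choose 2) / q ^ (n * k))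
            * qpoch (a * b * q ^ k) q (n - k) * qpoch (a * c * q ^ k) q (n - k) * qpoch (a * d * q ^ k) q (n - k)
            * qpoch (a * b * c * d * q ^ n / q) q k * qpoch (a * F) q k * qpoch (a / F) q k)"
    unfolding sum_distrib_left
  proof (rule sum.cong, goal_cases)
    case (2 k)
    then have k: "k \<le> n" by simp
    have split: "qpoch z q n = qpoch z q k * qpoch (z * q ^ k) q (n - k)" for z
      using qpoch_add[of z q k "n - k"] k by simp
    have p: "a * b * c * d * q powi (int n - 1) = a * b * c * d * q ^ n / q"
      using q by (simp add: power_int_diff)
    show ?case
      unfolding qpoch_neg_power[OF q k, symmetric] f_def qpochs_def p
      using nzs[of k] by (simp add: split[of "a * b"] split[of "a * c"] split[of "a * d"])
  qed simp
  finally show ?thesis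
    unfolding aw_sum_sears[OF q a F(1)] FE E_def[symmetric] using a
    by (simp add: power_int_minus mult.assoc)
qed

section \<open>Connection coefficients\<close>

text \<open>
  The connection coefficients of Askey and Wilson for polynomials that share the parameters
  \<open>b\<close>, \<open>c\<close>, \<open>d\<close>.
\<close>

definition connection_coeff :: "complex \<Rightarrow> complex \<Rightarrow> complex \<Rightarrow> complex \<Rightarrow> complex \<Rightarrow> complex \<Rightarrow> nat \<Rightarrow> nat \<Rightarrow> complex" where
  "connection_coeff \<alpha> a b c d q N n = qbin q N n * qpoch (c * d * q ^ n) q (N - n) * qpoch (b * c * q ^ n) q (N - n)
     * qpoch (b * d * q ^ n) q (N - n) * qdiff \<alpha> a q (N - n) * qpoch (a * b * c * d * q ^ N / q) q n
     * (1 - \<alpha> * b * c * d / q * q ^ (2 * n)) / qpoch (\<alpha> * b * c * d / q * q ^ n) q (Suc N)"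

text \<open>
  Both sides are expanded in the basis \<open>(bE,b/E;q)\<^sub>j\<close>. It belongs to a parameter that the two
  families share, so the coefficients can be compared for each \<open>j\<close>, and each comparison is a
  very-well-poised sum over \<open>n = j + m\<close>.
\<close>

lemma connection_nonzero:
  assumes q: "norm q < 1" "q \<noteq> 0" and nz: "\<And>k. \<alpha> * b * c * d / q * q ^ k \<noteq> 1"
    and \<alpha>: "\<alpha> \<noteq> 0" and b: "b \<noteq> 0" and E: "E \<noteq> 0"
  shows "aw_sum N a b c d E q = (\<Sum>n\<le>N. connection_coeff \<alpha> a b c d q N n * aw_sum n \<alpha> b c d E q)"
proof -
  define s where "s = (\<lambda>n k. (-1) ^ k * q ^ (Suc k choose 2) / q ^ (n * k))"
  define h where "h = (\<lambda>a n k. qbin q n k * s n k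
            * qpoch (b * a * q ^ k) q (n - k) * qpoch (b * c * q ^ k) q (n - k) * qpoch (b * d * q ^ k) q (n - k)
            * qpoch (b * a * c * d * q ^ n / q) q k * qpoch (b * E) q k * qpoch (b / E) q k)"
  \<comment> \<open>by the symmetry in \<open>a\<close> and \<open>b\<close>, the expansion in the basis belonging to \<open>b\<close>\<close>
  have U: "b ^ n * aw_sum n a b c d E q = (\<Sum>k\<le>n. h a n k)" for a n
    using aw_sum_sears[OF q b E, of n a c d] by (simp add: h_def s_def aw_sum_commute[of n a])
  have "b ^ N * (\<Sum>n\<le>N. connection_coeff \<alpha> a b c d q N n * aw_sum n \<alpha> b c d E q)
      = (\<Sum>n\<le>N. connection_coeff \<alpha> a b c d q N n * b ^ (N - n) * (b ^ n * aw_sum n \<alpha> b c d E q))"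
    unfolding sum_distrib_left
    by (rule sum.cong) (auto simp: mult_ac simp flip: power_add)
  also have "\<dots> = (\<Sum>n\<le>N. \<Sum>j\<le>n. connection_coeff \<alpha> a b c d q N n * b ^ (N - n) * h \<alpha> n j)"
    by (simp add: U sum_distrib_left)
  also have "\<dots> = (\<Sum>j\<le>N. \<Sum>m\<le>N - j. connection_coeff \<alpha> a b c d q N (j + m) * b ^ (N - (j + m)) * h \<alpha> (j + m) j)"
    by (rule sum_triangle)
  also have "\<dots> = (\<Sum>j\<le>N. h a N j)"
  proof (rule sum.cong, goal_cases)
    case (2 j)
    then obtain M where N: "N = j + M"
      using le_Suc_ex by auto
    define X where "X = \<alpha> * b * c * d / q"
    \<comment> \<open>base \<open>A\<close> and parameter \<open>B = \<alpha>\<beta>\<close> of the very-well-poised sum over \<open>m\<close>\<close>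
    define A where "A = X * q ^ j * q ^ j"
    define \<beta> where "\<beta> = b * q ^ j"
    define g where "g = (\<lambda>m. qbin q M m * (1 - A * q ^ (2 * m)) / qpoch (A * q ^ m) q (Suc M)
             * qpoch (\<alpha> * \<beta>) q m * qpoch (A * (a / \<alpha> * q ^ M)) q m
             * qdiff \<alpha> a q (M - m) * qpoch (c * d * q ^ j * q ^ m) q (M - m) * \<beta> ^ (M - m))"
    define C where "C = qbin q N j * s N j * qpoch (b * c * q ^ j) q M * qpoch (b * d * q ^ j) q M
       * qpoch (a * b * c * d * q ^ N / q) q j * qpoch (b * E) q j * qpoch (b / E) q j"
    have nzA: "A * q ^ k \<noteq> 1" for k
      using nz[of "j + j + k"] by (simp add: A_def X_def power_add mult_ac)
    have nzX: "qpoch (X * q ^ n) q k \<noteq> 0" for n k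
      unfolding qpoch_def using nz[of "n + _"] by (auto simp: X_def power_add mult_ac)
    have gs: "(\<Sum>m\<le>M. g m) = qpoch (a * \<beta>) q M"
      unfolding g_def
      by (rule very_well_poised_sum_connection[OF q nzA \<alpha>]) (use q in \<open>simp add: A_def X_def \<beta>_def power_add\<close>)
    have "connection_coeff \<alpha> a b c d q N (j + m) * b ^ (N - (j + m)) * h \<alpha> (j + m) j = C * g m" if m: "m \<le> M" for m
    proof -
      obtain r where M: "M = m + r" using m le_Suc_ex by auto
      have r: "N - (j + m) = r" "M - m = r" "j + m - j = m" by (simp_all add: N M)
      have bc: "qpoch (b * c * q ^ j) q m * qpoch (b * c * q ^ (j + m)) q r = qpoch (b * c * q ^ j) q M"
        and bd: "qpoch (b * d * q ^ j) q m * qpoch (b * d * q ^ (j + m)) q r = qpoch (b * d * q ^ j) q M"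
        by (simp_all only: qpoch_mult_shifted M)
      have "s N j = s (j + m) j / q ^ (j * r)"
        by (simp add: s_def N M power_add algebra_simps)
      then have bs: "b ^ r * s (j + m) j = s N j * \<beta> ^ r"
        using q by (simp add: \<beta>_def power_mult_distrib power_mult)
      have abcd: "qpoch (a * b * c * d * q ^ N / q) q (j + m)
          = qpoch (a * b * c * d * q ^ N / q) q j * qpoch (A * (a / \<alpha> * q ^ M)) q m"
        using \<alpha> by (simp add: qpoch_add A_def X_def N power_add mult_ac)
      have Xq: "b * \<alpha> * c * d * q ^ (j + m) / q = X * q ^ (j + m)"
        by (simp add: X_def mult_ac)
      have "Suc N = j + Suc M" by (simp add: N)
      then have "qpoch (X * q ^ (j + m)) q (Suc N) = qpoch (X * q ^ (j + m)) q j * qpoch (A * q ^ m) q (Suc M)"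
        by (simp only: qpoch_add) (simp add: A_def power_add mult_ac)
      then have X: "qpoch (X * q ^ (j + m)) q j / qpoch (X * q ^ (j + m)) q (Suc N) = 1 / qpoch (A * q ^ m) q (Suc M)"
        using nzX[of "j + m" j] by simp
      have A2: "X * q ^ (2 * (j + m)) = A * q ^ (2 * m)"
        unfolding mult_2 power_add A_def by (simp only: mult_ac)
      have cd: "c * d * q ^ (j + m) = c * d * q ^ j * q ^ m"
        by (simp add: power_add mult_ac)
      have ab: "b * \<alpha> * q ^ j = \<alpha> * \<beta>"
        by (simp add: \<beta>_def mult_ac)
      have "connection_coeff \<alpha> a b c d q N (j + m) * b ^ (N - (j + m)) * h \<alpha> (j + m) j
         = (qbin q N (j + m) * qbin q (j + m) j) * qpoch (c * d * q ^ (j + m)) q r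
           * (qpoch (b * c * q ^ j) q m * qpoch (b * c * q ^ (j + m)) q r)
           * (qpoch (b * d * q ^ j) q m * qpoch (b * d * q ^ (j + m)) q r)
           * qdiff \<alpha> a q r * qpoch (a * b * c * d * q ^ N / q) q (j + m)
           * (1 - X * q ^ (2 * (j + m))) * (b ^ r * s (j + m) j)
           * (qpoch (X * q ^ (j + m)) q j / qpoch (X * q ^ (j + m)) q (Suc N))
           * qpoch (b * \<alpha> * q ^ j) q m * qpoch (b * E) q j * qpoch (b / E) q j"
        unfolding connection_coeff_def h_def r X_def[symmetric] Xq by (simp only: mult_ac times_divide_eq_right times_divide_eq_left)
      also have "\<dots> = C * g m"
        unfolding qbin_trinomial[OF q(1) N m] bc bd bs abcd X A2 cd ab C_def g_def r
        by (simp only: mult_ac times_divide_eq_right times_divide_eq_left mult_1)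
      finally show ?thesis .
    qed
    then have "(\<Sum>m\<le>N - j. connection_coeff \<alpha> a b c d q N (j + m) * b ^ (N - (j + m)) * h \<alpha> (j + m) j) = C * (\<Sum>m\<le>M. g m)"
      by (simp add: N sum_distrib_left)
    also have "\<dots> = h a N j"
      unfolding gs by (simp add: C_def h_def N \<beta>_def mult_ac)
    finally show ?case .
  qed simp
  also have "\<dots> = b ^ N * aw_sum N a b c d E q"
    by (simp add: U)
  finally show ?thesis using b by simp
qed

lemma isCont_qpoch: "isCont f x \<Longrightarrow> isCont (\<lambda>b. qpoch (f b) q n) x"
  unfolding qpoch_def by (intro continuous_intros)

text \<open>
  For \<open>b = 0\<close> the basis \<open>(bE,b/E;q)\<^sub>j\<close> degenerates, but both sides are continuous in \<open>b\<close> at \<open>0\<close>, and near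
  \<open>0\<close> the product \<open>\<alpha>bcd/q\<close> is small enough for no denominator to vanish.
\<close>

lemma connection:
  assumes q: "norm q < 1" "q \<noteq> 0" and nz: "\<And>k. \<alpha> * b * c * d / q * q ^ k \<noteq> 1"
    and \<alpha>: "\<alpha> \<noteq> 0" and E: "E \<noteq> 0"
  shows "aw_sum N a b c d E q = (\<Sum>n\<le>N. connection_coeff \<alpha> a b c d q N n * aw_sum n \<alpha> b c d E q)"
proof (cases "b = 0")
  case False
  then show ?thesis by (rule connection_nonzero[OF q nz \<alpha> _ E])
next
  case True
  let ?L = "\<lambda>b. aw_sum N a b c d E q"
  let ?R = "\<lambda>b. \<Sum>n\<le>N. connection_coeff \<alpha> a b c d q N n * aw_sum n \<alpha> b c d E q"
  have cL: "isCont ?L 0"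
    unfolding aw_sum_def by (intro continuous_intros isCont_qpoch) (use E in auto)
  have cR: "isCont ?R 0"
    unfolding aw_sum_def connection_coeff_def by (intro continuous_intros isCont_qpoch) (use E q in auto)
  have "isCont (\<lambda>b. norm (\<alpha> * b * c * d / q)) 0"
    using q by (intro continuous_intros) auto
  then have "\<forall>\<^sub>F b in at 0. norm (\<alpha> * b * c * d / q) < 1"
    by (intro order_tendstoD) (auto simp: isCont_def)
  then have "\<forall>\<^sub>F b in at 0. ?R b = ?L b"
    using eventually_neq_at_within[of "0 :: complex" 0 UNIV]
  proof eventually_elim
    case (elim b)
    have nz': "\<alpha> * b * c * d / q * q ^ k \<noteq> 1" for k
    proof -
      have "norm (\<alpha> * b * c * d / q * q ^ k) \<le> norm (\<alpha> * b * c * d / q) * 1"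
        unfolding norm_mult[of _ "q ^ k"] norm_power using q
        by (intro mult_left_mono power_le_one) auto
      also have "\<dots> < 1" using elim by simp
      finally show ?thesis by force
    qed
    show ?case
      by (rule connection_nonzero[OF q nz' \<alpha> _ E, symmetric]) (rule elim(2))
  qed
  then have "?L \<midarrow>0\<rightarrow> ?R 0"
    by (rule Lim_transform_eventually[OF cR[unfolded isCont_def]])
  from LIM_unique[OF cL[unfolded isCont_def] this] have "?L 0 = ?R 0" .
  then show ?thesis using True by simp
qed

section \<open>Bounds for shifted factorials\<close>

text \<open>
  The bound is uniform in the shift \<open>i\<close>, since \<open>|1 - zq\<^sup>i\<^sup>+\<^sup>j| \<le> exp (|z| |q|\<^sup>j)\<close>.
\<close>

lemma qpoch_bounded:
  assumes q: "norm q < 1"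
  obtains K where "K > 0" "\<And>i n. norm (qpoch (z * q ^ i) q n) \<le> K"
proof
  show "exp (norm z / (1 - norm q)) > 0" by simp
  fix i n
  have "norm (qpoch (z * q ^ i) q n) = (\<Prod>j<n. norm (1 - z * q ^ i * q ^ j))"
    by (simp add: qpoch_def prod_norm)
  also have "\<dots> \<le> (\<Prod>j<n. exp (norm z * norm q ^ j))"
  proof (intro prod_mono conjI norm_ge_zero)
    fix j
    have "norm (z * q ^ i * q ^ j) \<le> norm z * 1 * norm q ^ j"
      unfolding norm_mult norm_power using q by (intro mult_right_mono mult_left_mono power_le_one) auto
    then have "norm (1 - z * q ^ i * q ^ j) \<le> 1 + norm z * norm q ^ j"
      using norm_triangle_ineq4[of 1 "z * q ^ i * q ^ j"] by simp
    then show "norm (1 - z * q ^ i * q ^ j) \<le> exp (norm z * norm q ^ j)"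
      using exp_ge_add_one_self[of "norm z * norm q ^ j"] by linarith
  qed
  also have "\<dots> = exp (norm z * (\<Sum>j<n. norm q ^ j))"
    by (simp add: exp_sum sum_distrib_left)
  also have "(\<Sum>j<n. norm q ^ j) \<le> (\<Sum>j. norm q ^ j)"
    using q by (intro sum_le_suminf summable_geometric) auto
  also have "(\<Sum>j. norm q ^ j) = 1 / (1 - norm q)"
    using q by (intro suminf_geometric) auto
  finally show "norm (qpoch (z * q ^ i) q n) \<le> exp (norm z / (1 - norm q))"
    by (simp add: mult_left_mono)
qed

text \<open>
  The infinite product converges to a nonzero limit, which bounds \<open>1/(z;q)\<^sub>n\<close>; the shift by \<open>i\<close> is
  reduced to this through \<open>(zq\<^sup>i;q)\<^sub>n = (z;q)\<^sub>i\<^sub>+\<^sub>n / (z;q)\<^sub>i\<close>.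
\<close>

lemma qpoch_bounded_below:
  assumes q: "norm q < 1" and nz: "\<And>k. z * q ^ k \<noteq> 1"
  obtains K where "K > 0" "\<And>i n. norm (inverse (qpoch (z * q ^ i) q n)) \<le> K"
proof -
  have nzs: "qpoch z q n \<noteq> 0" for n
    using nz by (auto simp: qpoch_def)
  have "abs_convergent_prod (\<lambda>k. 1 - z * q ^ k)"
    unfolding abs_convergent_prod_conv_summable using q
    by (simp add: norm_mult norm_power summable_mult summable_geometric)
  then have "convergent_prod (\<lambda>k. 1 - z * q ^ k)"
    by (rule abs_convergent_prod_imp_convergent_prod)
  then obtain L where L: "(\<lambda>n. \<Prod>i\<le>n. 1 - z * q ^ i) \<longlonglongrightarrow> L" "L \<noteq> 0"
    using convergent_prod_iff_nz_lim[of "\<lambda>k. 1 - z * q ^ k"] nz by auto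
  then have "(\<lambda>n. qpoch z q (Suc n)) \<longlonglongrightarrow> L"
    by (simp add: qpoch_def lessThan_Suc_atMost del: prod.lessThan_Suc)
  then have "(\<lambda>n. qpoch z q n) \<longlonglongrightarrow> L"
    by (simp only: filterlim_sequentially_Suc)
  then have "(\<lambda>n. inverse (qpoch z q n)) \<longlonglongrightarrow> inverse L"
    using L(2) by (rule tendsto_inverse)
  then have "Bseq (\<lambda>n. inverse (qpoch z q n))"
    by (intro convergent_imp_Bseq convergentI)
  then obtain K where K: "K > 0" "\<And>n. norm (inverse (qpoch z q n)) \<le> K"
    by (auto simp: Bseq_def)
  obtain K' where K': "K' > 0" "\<And>i n. norm (qpoch (z * q ^ i) q n) \<le> K'"
    using qpoch_bounded[OF q] by blast
  show ?thesis
  proof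
    show "K' * K > 0" using K(1) K'(1) by simp
    fix i n
    have "inverse (qpoch (z * q ^ i) q n) = qpoch z q i * inverse (qpoch z q (i + n))"
      using nzs[of i] by (simp add: qpoch_add field_simps)
    then show "norm (inverse (qpoch (z * q ^ i) q n)) \<le> K' * K"
      using mult_mono[OF K'(2)[of 0 i] K(2)[of "i + n"]] K'(1) by (simp add: norm_mult)
  qed
qed

text \<open>
  Bounded families with two indices. Closure under products and under division by shifted
  factorials reduces the estimates below to reading off the factors.
\<close>

definition bounded_family :: "(nat \<times> nat \<Rightarrow> complex) \<Rightarrow> bool" where
  "bounded_family f \<longleftrightarrow> (\<exists>K>0. \<forall>x. norm (f x) \<le> K)"

lemma bounded_family_mult: "bounded_family f \<Longrightarrow> bounded_family g \<Longrightarrow> bounded_family (\<lambda>x. f x * g x)"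
  unfolding bounded_family_def
proof (elim exE conjE)
  fix K L assume "K > 0" "\<forall>x. norm (f x) \<le> K" "L > 0" "\<forall>x. norm (g x) \<le> L"
  then show "\<exists>K>0. \<forall>x. norm (f x * g x) \<le> K"
    by (intro exI[of _ "K * L"]) (auto simp: norm_mult intro!: mult_mono)
qed

lemma bounded_family_qpoch: "norm q < 1 \<Longrightarrow> bounded_family (\<lambda>x. qpoch (z * q ^ i x) q (k x))"
  unfolding bounded_family_def using qpoch_bounded[of q z] by metis

lemma bounded_family_qpoch0: "norm q < 1 \<Longrightarrow> bounded_family (\<lambda>x. qpoch z q (k x))"
  using bounded_family_qpoch[of q z "\<lambda>_. 0" k] by simp

lemma bounded_family_divide_qpoch:
  assumes "bounded_family f" "norm q < 1" "\<And>k. z * q ^ k \<noteq> 1"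
  shows "bounded_family (\<lambda>x. f x / qpoch (z * q ^ i x) q (k x))"
proof -
  have "bounded_family (\<lambda>x. inverse (qpoch (z * q ^ i x) q (k x)))"
    unfolding bounded_family_def using qpoch_bounded_below[OF assms(2,3)] by metis
  from bounded_family_mult[OF assms(1) this] show ?thesis
    by (simp add: field_simps)
qed

lemma bounded_family_divide_qpoch0:
  assumes "bounded_family f" "norm q < 1" "\<And>k. z * q ^ k \<noteq> 1"
  shows "bounded_family (\<lambda>x. f x / qpoch z q (k x))"
  using bounded_family_divide_qpoch[OF assms, of "\<lambda>_. 0" k] by simp

lemma aw_sum_bound:
  assumes q: "norm q < 1" and E: "norm E = 1"
  obtains K where "K > 0" "\<And>n. norm (aw_sum n a b c d E q) \<le> K * (real n + 1)"
proof -
  define f where "f = (\<lambda>(n, k). qpoch q q n / qpoch q q k / qpoch q q (n - k)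
     * qpoch (a * b * q ^ k) q (n - k) * qpoch (c * d * q ^ (n - k)) q k
     * qpoch (a * E) q k * qpoch (b * E) q k * qpoch (c / E) q (n - k) * qpoch (d / E) q (n - k))"
  have "bounded_family f"
    unfolding f_def case_prod_unfold
    by (intro bounded_family_mult bounded_family_divide_qpoch0 bounded_family_qpoch bounded_family_qpoch0 q q_power_neq_1)
  then obtain K where K: "K > 0" "\<And>n k. norm (f (n, k)) \<le> K"
    unfolding bounded_family_def by auto
  show ?thesis
  proof
    show "K > 0" by (rule K(1))
    fix n
    have "norm (aw_sum n a b c d E q) \<le> (\<Sum>k\<le>n. norm (f (n, k) * E ^ (n - k) / E ^ k))"
      unfolding aw_sum_def f_def qbin_def
      by (intro order_trans[OF norm_sum] sum_mono) simp
    also have "\<dots> \<le> (\<Sum>k\<le>n. K)"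
      using K(2) E by (intro sum_mono) (simp add: norm_mult norm_divide norm_power)
    finally show "norm (aw_sum n a b c d E q) \<le> K * (real n + 1)" by (simp add: algebra_simps)
  qed
qed

section \<open>The generating function\<close>

text \<open>
  The generating function of Ismail and Wilson: a Cauchy product, by the choice of \<open>aw_sum\<close>.
\<close>

lemma aw_sum_generating_function:
  assumes q: "norm q < 1" and E: "norm E = 1" and t: "norm t < 1"
    and ab: "\<And>k. a * b * q ^ k \<noteq> 1" and cd: "\<And>k. c * d * q ^ k \<noteq> 1"
  shows "(\<lambda>N. t ^ N * aw_sum N a b c d E q / (qpoch q q N * qpoch (a * b) q N * qpoch (c * d) q N)) sums
     ((\<Sum>k. qpoch (a * E) q k * qpoch (b * E) q k / (qpoch q q k * qpoch (a * b) q k) * (t / E) ^ k)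
      * (\<Sum>k. qpoch (c / E) q k * qpoch (d / E) q k / (qpoch q q k * qpoch (c * d) q k) * (t * E) ^ k))"
proof -
  have summ: "summable (\<lambda>k. norm (qpoch x q k * qpoch y q k / (qpoch q q k * qpoch z q k) * w ^ k))"
    if z: "\<And>k. z * q ^ k \<noteq> 1" and w: "norm w < 1" for x y z w
  proof -
    have "bounded_family (\<lambda>(k, l). qpoch x q k * qpoch y q k / qpoch q q k / qpoch z q k)"
      unfolding case_prod_unfold
      by (intro bounded_family_mult bounded_family_divide_qpoch0 bounded_family_qpoch0 q q_power_neq_1 z)
    then obtain K where K: "\<And>k. norm (qpoch x q k * qpoch y q k / qpoch q q k / qpoch z q k) \<le> K"
      unfolding bounded_family_def by auto
    show ?thesis
    proof (rule summable_comparison_test'[where N = 0])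
      show "summable (\<lambda>k. K * norm w ^ k)"
        using w by (intro summable_mult summable_geometric) simp
      fix k :: nat
      have "norm (qpoch x q k * qpoch y q k / qpoch q q k / qpoch z q k) * norm w ^ k \<le> K * norm w ^ k"
        by (intro mult_right_mono K) simp
      then show "norm (norm (qpoch x q k * qpoch y q k / (qpoch q q k * qpoch z q k) * w ^ k)) \<le> K * norm w ^ k"
        by (simp add: norm_mult norm_divide norm_power)
    qed
  qed
  have E0: "E \<noteq> 0" using E by auto
  have nz: "qpoch (a * b) q k \<noteq> 0" "qpoch (c * d) q k \<noteq> 0" "qpoch q q k \<noteq> 0" for k
    using ab cd qpoch_q_nonzero[OF q] by (auto simp: qpoch_def)
  define f where "f = (\<lambda>k. qpoch (a * E) q k * qpoch (b * E) q k / (qpoch q q k * qpoch (a * b) q k) * (t / E) ^ k)"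
  define g where "g = (\<lambda>k. qpoch (c / E) q k * qpoch (d / E) q k / (qpoch q q k * qpoch (c * d) q k) * (t * E) ^ k)"
  have "(\<lambda>N. \<Sum>k\<le>N. f k * g (N - k)) sums ((\<Sum>k. f k) * (\<Sum>k. g k))"
    using summ[of "a * b" "t / E" "a * E" "b * E"] summ[of "c * d" "t * E" "c / E" "d / E"] ab cd t E
    by (intro Cauchy_product_sums) (simp_all add: f_def g_def norm_mult norm_divide)
  moreover have "(\<Sum>k\<le>N. f k * g (N - k))
     = t ^ N * aw_sum N a b c d E q / (qpoch q q N * qpoch (a * b) q N * qpoch (c * d) q N)" for N
    unfolding aw_sum_def sum_distrib_left sum_divide_distrib
  proof (rule sum.cong, goal_cases)
    case (2 k)
    then obtain r where N: "N = k + r" using le_Suc_ex by auto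
    have 1: "qpoch (a * b) q N = qpoch (a * b) q k * qpoch (a * b * q ^ k) q r"
      by (simp add: N qpoch_add)
    have 2: "qpoch (c * d) q N = qpoch (c * d) q r * qpoch (c * d * q ^ r) q k"
      using qpoch_add[of "c * d" q r k] by (simp add: N add.commute)
    have nz': "qpoch (a * b * q ^ k) q r \<noteq> 0" "qpoch (c * d * q ^ r) q k \<noteq> 0"
      using nz(1)[of N] nz(2)[of N] unfolding 1 2 by auto
    have 3: "N - k = r" by (simp add: N)
    show ?case
      unfolding f_def g_def qbin_def 1 2 3 using nz nz' E0
      by (simp add: N power_add power_mult_distrib power_divide field_simps)
  qed simp
  ultimately show ?thesis by (simp add: f_def g_def)
qed

section \<open>The expansion of the product\<close>

text \<open>
  Rearranging a double series from diagonals to columns; the product bound makes it absolutely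
  convergent.
\<close>

lemma double_sum_by_columns:
  fixes f :: "nat \<Rightarrow> nat \<Rightarrow> complex" and g h :: "nat \<Rightarrow> real"
  assumes f: "\<And>n m. norm (f n m) \<le> g n * h m" and g: "summable g" and h: "summable h"
    and diag: "(\<lambda>N. \<Sum>n\<le>N. f n (N - n)) sums S"
  shows "(\<lambda>n. \<Sum>m. f n m) sums S" "\<And>n. summable (f n)"
proof -
  have inner: "summable (\<lambda>m. norm (f n m))" for n
    by (rule summable_comparison_test'[where N = 0, OF summable_mult[OF h, of "g n"]])
      (simp add: f)
  then show "summable (f n)" for n
    by (rule summable_norm_cancel)
  have "0 \<le> g n * h m" for n m
    using f[of n m] norm_ge_zero order_trans by blast
  then have gh: "\<bar>g n\<bar> * \<bar>h m\<bar> = g n * h m" for n m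
    by (metis abs_mult abs_of_nonneg)
  have "(\<lambda>x. norm (f (fst x) (snd x))) summable_on (SIGMA n:UNIV. UNIV)"
  proof (rule summable_on_SigmaI[where g = "\<lambda>n. \<Sum>m. norm (f n m)"])
    fix n :: nat
    have "((\<lambda>m. norm (f n m)) has_sum (\<Sum>m. norm (f n m))) UNIV"
      by (rule norm_summable_imp_has_sum) (use inner in \<open>simp_all add: summable_sums\<close>)
    then show "((\<lambda>m. norm (f (fst (n, m)) (snd (n, m)))) has_sum (\<Sum>m. norm (f n m))) UNIV"
      by simp
  next
    have "norm (\<Sum>m. norm (f n m)) \<le> g n * (\<Sum>m. h m)" for n
      using suminf_le[OF _ inner summable_mult[OF h], of n "g n"] f[of n]
      by (simp add: suminf_nonneg inner suminf_mult h)
    then have "summable (\<lambda>n. norm (\<Sum>m. norm (f n m)))"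
      by (intro summable_comparison_test'[where N = 0, OF summable_mult2[OF g, of "\<Sum>m. h m"]]) simp
    then show "(\<lambda>n. \<Sum>m. norm (f n m)) summable_on UNIV"
      by (rule norm_summable_imp_summable_on)
  qed auto
  then have "(\<lambda>x. norm (case x of (n, m) \<Rightarrow> f n m)) summable_on (SIGMA n:UNIV. UNIV)"
    by (simp add: case_prod_unfold)
  then have "(\<lambda>(n, m). f n m) summable_on (SIGMA n:UNIV. UNIV)"
    by (rule abs_summable_summable)
  then obtain I where I: "((\<lambda>(n, m). f n m) has_sum I) (SIGMA n:UNIV. UNIV)"
    by (auto simp: summable_on_def)
  have "((\<lambda>n. \<Sum>m. f n m) has_sum I) UNIV"
    using I
    by (rule has_sum_SigmaD)
      (simp add: norm_summable_imp_has_sum[OF inner] summable_sums[OF summable_norm_cancel[OF inner]])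
  then have col: "(\<lambda>n. \<Sum>m. f n m) sums I"
    by (rule has_sum_imp_sums)
  have "((\<lambda>(N, n). f n (N - n)) has_sum I) (SIGMA N:UNIV. {..N})"
    by (subst has_sum_reindex_bij_witness[where T = "SIGMA n:UNIV. UNIV" and h = "\<lambda>(n, m). f n m"
           and j = "\<lambda>(N, n). (n, N - n)" and i = "\<lambda>(n, m). (n + m, n)"]) (use I in auto)
  then have "((\<lambda>N. \<Sum>n\<le>N. f n (N - n)) has_sum I) UNIV"
    by (rule has_sum_SigmaD) (simp add: has_sum_finite)
  then have "(\<lambda>N. \<Sum>n\<le>N. f n (N - n)) sums I"
    by (rule has_sum_imp_sums)
  with diag have "S = I" by (rule sums_unique2)
  with col show "(\<lambda>n. \<Sum>m. f n m) sums S" by simp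
qed

text \<open>
  The \<open>(n, m)\<close> term of the double series: the coefficient of the \<open>n\<close>-th polynomial times the \<open>m\<close>-th
  term of the \<open>\<^sub>4\<phi>\<^sub>3\<close>, with cancelling factorials removed. The sequence \<open>u\<close> stands for the
  polynomials.
\<close>

definition expansion_term :: "complex \<Rightarrow> complex \<Rightarrow> complex \<Rightarrow> complex \<Rightarrow> complex \<Rightarrow> complex \<Rightarrow> complex \<Rightarrow> (nat \<Rightarrow> complex) \<Rightarrow> nat \<Rightarrow> nat \<Rightarrow> complex" where
  "expansion_term \<alpha> a b c d q t u n m = t ^ n * (\<alpha> * t) ^ m * qpoch (a / \<alpha>) q m
     * qpoch (b * c * q ^ n) q m * qpoch (b * d * q ^ n) q m
     * qpoch (a * b * c * d / q * q ^ (n + m)) q n * (1 - \<alpha> * b * c * d / q * q ^ (2 * n)) * u n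
     / qpoch (\<alpha> * b * c * d / q * q ^ n) q (Suc (n + m)) / qpoch q q n / qpoch q q m
     / qpoch (c * d) q n / qpoch (a * b) q (n + m)"

text \<open>
  Read along the diagonal \<open>N = n + m\<close>: a summand of the connection formula.
\<close>

lemma expansion_term_diagonal:
  assumes q: "norm q < 1" and \<alpha>: "\<alpha> \<noteq> 0"
    and cd: "\<And>k. c * d * q ^ k \<noteq> 1"
  shows "expansion_term \<alpha> a b c d q t u n m = t ^ (n + m) * (connection_coeff \<alpha> a b c d q (n + m) n * u n)
      / (qpoch q q (n + m) * qpoch (a * b) q (n + m) * qpoch (c * d) q (n + m))"
proof -
  have nz: "qpoch q q (n + m) \<noteq> 0" "qpoch (c * d * q ^ n) q m \<noteq> 0"
    using qpoch_q_nonzero[OF q] cd[of "n + _"] by (auto simp: qpoch_def power_add mult_ac)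
  have qd: "qdiff \<alpha> a q m = \<alpha> ^ m * qpoch (a / \<alpha>) q m"
    using \<alpha> by (induction m) (simp_all add: qdiff_Suc qpoch_Suc field_simps)
  have m: "n + m - n = m" by simp
  have W: "a * b * c * d * q ^ (n + m) / q = a * b * c * d / q * q ^ (n + m)"
    by simp
  show ?thesis
    unfolding expansion_term_def connection_coeff_def qbin_def m qd W qpoch_add[of "c * d"]
    using nz by (simp add: power_mult_distrib power_add mult_ac)
qed

text \<open>
  Read along a column: a term of the \<open>\<^sub>4\<phi>\<^sub>3\<close> series.
\<close>

lemma expansion_term_column:
  assumes q: "norm q < 1" "q \<noteq> 0"
    and Y: "\<And>k. \<alpha> * b * c * d / q * q ^ k \<noteq> 1" and W: "\<And>k. a * b * c * d / q * q ^ k \<noteq> 1"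
  shows "expansion_term \<alpha> a b c d q t u n m =
       t ^ n * qpochs [\<alpha> * b * c * d / q,
                  csqrt (a * b * c * d / q), - csqrt (a * b * c * d / q),
                  csqrt (a * b * c * d), - csqrt (a * b * c * d)] q n
        / qpochs [a * b, c * d, a * b * c * d / q,
                  csqrt (\<alpha> * b * c * d / q), - csqrt (\<alpha> * b * c * d / q),
                  csqrt (\<alpha> * b * c * d), - csqrt (\<alpha> * b * c * d)] q n
        * (qpochs [a / \<alpha>, b * c * q ^ n, b * d * q ^ n, a * b * c * d * q powi (2 * int n - 1)] q m
           / qpochs [q, a * b * q ^ n, a * b * c * d * q powi (int n - 1), \<alpha> * b * c * d * q ^ (2 * n)] q m
           * (\<alpha> * t) ^ m) * (u n / qpoch q q n)"
proof -
  define X where "X = \<alpha> * b * c * d / q"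
  define V where "V = a * b * c * d / q"
  have nz: "qpoch (X * q ^ i) q k \<noteq> 0" "qpoch (V * q ^ i) q k \<noteq> 0" for i k
    using Y[of "i + _"] W[of "i + _"] by (auto simp: qpoch_def X_def V_def power_add mult_ac)
  have sX: "qpoch (csqrt X) q n * qpoch (- csqrt X) q n * qpoch (csqrt (X * q)) q n * qpoch (- csqrt (X * q)) q n
      = qpoch X q (2 * n)" for X
    using qpoch_square_split[of "csqrt (X * q)" "csqrt X" q n] by simp
  have e: "a * b * c * d = V * q" "\<alpha> * b * c * d = X * q" "V * q / q = V" "X * q / q = X"
    using q by (simp_all add: X_def V_def)
  have p: "V * q * q powi (2 * int n - 1) = V * q ^ (2 * n)" "V * q * q powi (int n - 1) = V * q ^ n"
    using q by (simp_all add: power_int_diff power_int_mult power_mult power_int_power)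
  have "qpoch V q (2 * n) * qpoch (V * q ^ (2 * n)) q m = qpoch V q n * qpoch (V * q ^ n) q m * qpoch (V * q ^ (n + m)) q n"
  proof -
    have "qpoch V q (2 * n) * qpoch (V * q ^ (2 * n)) q m = qpoch V q (n + m + n)"
      unfolding qpoch_add[symmetric] by (simp add: mult_2 add_ac)
    then show ?thesis by (simp add: qpoch_add)
  qed
  then have V: "qpoch V q (2 * n) * qpoch (V * q ^ (2 * n)) q m / (qpoch V q n * qpoch (V * q ^ n) q m)
      = qpoch (V * q ^ (n + m)) q n"
    using nz(2)[of 0 n] nz(2)[of n m] by simp
  have "qpoch X q n * qpoch (X * q ^ n) q (Suc (n + m)) = qpoch X q (2 * n + Suc m)"
    unfolding qpoch_add[symmetric] by (simp add: mult_2 add_ac)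
  also have "\<dots> = qpoch X q (2 * n) * ((1 - X * q ^ (2 * n)) * qpoch (X * q * q ^ (2 * n)) q m)"
    unfolding qpoch_add qpoch_Suc_left by (simp only: mult_ac)
  finally have X: "qpoch X q n / (qpoch X q (2 * n) * qpoch (X * q * q ^ (2 * n)) q m)
      = (1 - X * q ^ (2 * n)) / qpoch (X * q ^ n) q (Suc (n + m))"
    using nz(1)[of 0 "2 * n"] nz(1)[of n "Suc (n + m)"] nz(1)[of "2 * n + 1" m]
    by (simp add: frac_eq_eq mult_ac)
  have ab: "qpoch (a * b) q (n + m) = qpoch (a * b) q n * qpoch (a * b * q ^ n) q m"
    by (rule qpoch_add)
  have "qpochs [X, csqrt V, - csqrt V, csqrt (V * q), - csqrt (V * q)] q n = qpoch X q n * qpoch V q (2 * n)"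
    "qpochs [a * b, c * d, V, csqrt X, - csqrt X, csqrt (X * q), - csqrt (X * q)] q n
      = qpoch (a * b) q n * qpoch (c * d) q n * qpoch V q n * qpoch X q (2 * n)"
    unfolding qpochs_def by (simp_all add: mult.assoc flip: sX)
  note c = this
  define K where "K = t ^ n * (\<alpha> * t) ^ m * qpoch (a / \<alpha>) q m
     * qpoch (b * c * q ^ n) q m * qpoch (b * d * q ^ n) q m * u n
     / qpoch q q n / qpoch q q m / qpoch (c * d) q n / qpoch (a * b) q (n + m)"
  have "expansion_term \<alpha> a b c d q t u n m = K * qpoch (V * q ^ (n + m)) q n
      * ((1 - X * q ^ (2 * n)) / qpoch (X * q ^ n) q (Suc (n + m)))"
    unfolding expansion_term_def K_def X_def[symmetric] V_def[symmetric]
    by (simp only: mult_ac times_divide_eq_right times_divide_eq_left)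
  also have "\<dots> = t ^ n * (qpoch X q n * qpoch V q (2 * n))
      / (qpoch (a * b) q n * qpoch (c * d) q n * qpoch V q n * qpoch X q (2 * n))
      * (qpochs [a / \<alpha>, b * c * q ^ n, b * d * q ^ n, V * q ^ (2 * n)] q m
         / qpochs [q, a * b * q ^ n, V * q ^ n, X * q * q ^ (2 * n)] q m * (\<alpha> * t) ^ m)
      * (u n / qpoch q q n)"
    unfolding V[symmetric] X[symmetric] K_def ab qpochs_def by (simp, simp only: mult_ac)
  finally show ?thesis
    unfolding c[symmetric] p[symmetric] unfolding e .
qed

lemma expansion_term_bound:
  assumes q: "norm q < 1" and u: "\<And>n. norm (u n) \<le> K * (real n + 1)"
    and nz: "\<And>k. a * b * q ^ k \<noteq> 1" "\<And>k. c * d * q ^ k \<noteq> 1" "\<And>k. \<alpha> * b * c * d / q * q ^ k \<noteq> 1"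
  obtains L where "\<And>n m. norm (expansion_term \<alpha> a b c d q t u n m)
     \<le> (L * (real n + 1) * norm t ^ n) * norm (\<alpha> * t) ^ m"
proof -
  define f where "f = (\<lambda>x. (\<lambda>(n, m). qpoch (a / \<alpha>) q m
     * qpoch (b * c * q ^ n) q m * qpoch (b * d * q ^ n) q m
     * qpoch (a * b * c * d / q * q ^ (n + m)) q n * qpoch (\<alpha> * b * c * d / q * q ^ (2 * n)) q 1
     / qpoch (\<alpha> * b * c * d / q * q ^ n) q (Suc (n + m)) / qpoch q q n / qpoch q q m
     / qpoch (c * d) q n / qpoch (a * b) q (n + m)) x)"
  have "bounded_family f"
    unfolding f_def case_prod_unfold
    by (intro bounded_family_mult bounded_family_divide_qpoch0 bounded_family_divide_qpoch bounded_family_qpoch bounded_family_qpoch0 q q_power_neq_1 nz)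
  then obtain B where B: "B > 0" "\<And>n m. norm (f (n, m)) \<le> B"
    unfolding bounded_family_def by auto
  show ?thesis
  proof
    fix n m
    have "expansion_term \<alpha> a b c d q t u n m = f (n, m) * u n * (t ^ n * (\<alpha> * t) ^ m)"
      unfolding f_def expansion_term_def by (simp add: qpoch_Suc)
    then have "norm (expansion_term \<alpha> a b c d q t u n m) = norm (f (n, m)) * norm (u n) * (norm t ^ n * norm (\<alpha> * t) ^ m)"
      by (simp add: norm_mult norm_power)
    also have "\<dots> \<le> B * (K * (real n + 1)) * (norm t ^ n * norm (\<alpha> * t) ^ m)"
      using B by (intro mult_right_mono mult_mono u) auto
    finally show "norm (expansion_term \<alpha> a b c d q t u n m)
       \<le> ((B * K) * (real n + 1) * norm t ^ n) * norm (\<alpha> * t) ^ m"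
      by (simp add: mult_ac)
  qed
qed

lemma summable_linear_geometric:
  fixes r :: real
  assumes "0 \<le> r" "r < 1"
  shows "summable (\<lambda>n. L * (real n + 1) * r ^ n)"
proof -
  have "summable (\<lambda>n. diffs (\<lambda>_. 1) n * r ^ n)"
    by (rule termdiff_converges[where K = 1]) (use assms in \<open>auto intro: summable_geometric\<close>)
  then have "summable (\<lambda>n. L * (diffs (\<lambda>_. 1) n * r ^ n))"
    by (rule summable_mult)
  then show ?thesis by (simp add: diffs_def mult.assoc add.commute)
qed

text \<open>
  The theorem without reference to cosines, square roots and hypergeometric notation: the columns
  of the double series are summed instead of its diagonals.
\<close>

lemma product_expansion:
  assumes q: "norm q < 1" "q \<noteq> 0" and E: "norm E = 1" and t: "norm t < 1" "norm (\<alpha> * t) < 1"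
    and ab: "\<And>k. a * b * q ^ k \<noteq> 1" and cd: "\<And>k. c * d * q ^ k \<noteq> 1"
    and \<alpha>: "\<alpha> \<noteq> 0" and Y: "\<And>k. \<alpha> * b * c * d / q * q ^ k \<noteq> 1"
  defines "G \<equiv> expansion_term \<alpha> a b c d q t (\<lambda>n. aw_sum n \<alpha> b c d E q)"
  shows "(\<lambda>n. \<Sum>m. G n m) sums
     ((\<Sum>k. qpoch (a * E) q k * qpoch (b * E) q k / (qpoch q q k * qpoch (a * b) q k) * (t / E) ^ k)
      * (\<Sum>k. qpoch (c / E) q k * qpoch (d / E) q k / (qpoch q q k * qpoch (c * d) q k) * (t * E) ^ k))"
    "\<And>n. summable (G n)"
proof -
  have E0: "E \<noteq> 0" using E by auto
  obtain K where K: "\<And>n. norm (aw_sum n \<alpha> b c d E q) \<le> K * (real n + 1)"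
    using aw_sum_bound[OF q(1) E] by metis
  obtain L where L: "\<And>n m. norm (G n m) \<le> (L * (real n + 1) * norm t ^ n) * norm (\<alpha> * t) ^ m"
    using expansion_term_bound[OF q(1) K ab cd Y] unfolding G_def by metis
  have diag: "(\<Sum>n\<le>N. G n (N - n))
     = t ^ N * aw_sum N a b c d E q / (qpoch q q N * qpoch (a * b) q N * qpoch (c * d) q N)" for N
    unfolding connection[OF q Y \<alpha> E0, of N a] sum_distrib_left sum_divide_distrib
    by (rule sum.cong) (auto simp: G_def expansion_term_diagonal[OF q(1) \<alpha> cd])
  have gf: "(\<lambda>N. \<Sum>n\<le>N. G n (N - n)) sums
     ((\<Sum>k. qpoch (a * E) q k * qpoch (b * E) q k / (qpoch q q k * qpoch (a * b) q k) * (t / E) ^ k)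
      * (\<Sum>k. qpoch (c / E) q k * qpoch (d / E) q k / (qpoch q q k * qpoch (c * d) q k) * (t * E) ^ k))"
    unfolding diag by (rule aw_sum_generating_function[OF q(1) E t(1) ab cd])
  have s: "summable (\<lambda>n. L * (real n + 1) * norm t ^ n)" "summable (\<lambda>m. norm (\<alpha> * t) ^ m)"
    using t by (auto intro: summable_linear_geometric summable_geometric simp del: norm_mult)
  show "(\<lambda>n. \<Sum>m. G n m) sums
     ((\<Sum>k. qpoch (a * E) q k * qpoch (b * E) q k / (qpoch q q k * qpoch (a * b) q k) * (t / E) ^ k)
      * (\<Sum>k. qpoch (c / E) q k * qpoch (d / E) q k / (qpoch q q k * qpoch (c * d) q k) * (t * E) ^ k))"
    by (rule double_sum_by_columns(1)[OF L s gf])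
  show "summable (G n)" for n
    by (rule double_sum_by_columns(2)[OF L s gf])
qed

text \<open>
  If the factor \<open>c v\<close> vanishes, the series of the \<open>f m\<close> may diverge, but then both sides are \<open>0\<close>.
\<close>

lemma suminf_factor:
  fixes f :: "nat \<Rightarrow> complex"
  assumes "summable (\<lambda>m. c * f m * v)"
  shows "(\<Sum>m. c * f m * v) = c * (\<Sum>m. f m) * v"
proof (cases "c * v = 0")
  case False
  have "(\<lambda>m. inverse (c * v) * (c * f m * v)) = f"
    using False by (auto simp: field_simps)
  then have "summable f"
    using summable_mult[OF assms, of "inverse (c * v)"] by simp
  then show ?thesis
    by (simp add: suminf_mult suminf_mult2[symmetric] summable_mult)
qed auto

theorem theorem16:
  fixes q \<theta> x :: real and t a b c d \<alpha> :: complex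
  assumes x: "x = cos \<theta>"
    and q: "0 < \<bar>q\<bar>" "\<bar>q\<bar> < 1"
    and t: "norm t < (1 - q) ^ 3"
    and conj_pairs: "image_mset cnj {#a, b, c, d#} = {#a, b, c, d#}"
    and params: "Max {norm a, norm b, norm c, norm d} < 1"
    \<comment> \<open>convergence of the nonterminating series; the first is implied by \<open>t\<close> if \<open>q > 0\<close>\<close>
    and conv: "norm t < 1" "norm (\<alpha> * t) < 1"
    \<comment> \<open>no division by zero\<close>
    and nondeg: "\<alpha> \<noteq> 0" "a * b * c * d \<noteq> q"
      "\<And>k::nat. \<alpha> * b * c * d * q ^ k \<noteq> q"
      "\<And>k::nat. \<alpha> * b * q ^ k \<noteq> 1"
      "\<And>k::nat. \<alpha> * c * q ^ k \<noteq> 1"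
      "\<And>k::nat. \<alpha> * d * q ^ k \<noteq> 1"
  shows
    "(\<lambda>n. t ^ n
        * qpochs [\<alpha> * b * c * d / q,
                  csqrt (a * b * c * d / q), - csqrt (a * b * c * d / q),
                  csqrt (a * b * c * d), - csqrt (a * b * c * d)] q n
        / qpochs [a * b, c * d, a * b * c * d / q,
                  csqrt (\<alpha> * b * c * d / q), - csqrt (\<alpha> * b * c * d / q),
                  csqrt (\<alpha> * b * c * d), - csqrt (\<alpha> * b * c * d)] q n
        * basic_hypergeom
            [a / \<alpha>, b * c * q ^ n, b * d * q ^ n, a * b * c * d * q powi (2 * int n - 1)]
            [a * b * q ^ n, a * b * c * d * q powi (int n - 1), \<alpha> * b * c * d * q ^ (2 * n)]
            q (\<alpha> * t)
        * (askey_wilson n x \<alpha> b c d q / qpoch q q n))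
     sums
     (basic_hypergeom [a * exp (\<i> * \<theta>), b * exp (\<i> * \<theta>)] [a * b] q (t * exp (- \<i> * \<theta>))
      * basic_hypergeom [c * exp (- \<i> * \<theta>), d * exp (- \<i> * \<theta>)] [c * d] q (t * exp (\<i> * \<theta>)))"
proof -
  define Q where "Q = complex_of_real q"
  define E where "E = exp (\<i> * complex_of_real \<theta>)"
  have Q: "norm Q < 1" "Q \<noteq> 0" using q by (auto simp: Q_def)
  have E: "norm E = 1" "exp (- \<i> * complex_of_real \<theta>) = 1 / E"
    by (simp_all add: E_def exp_minus field_simps)
  have n1: "norm a < 1" "norm b < 1" "norm c < 1" "norm d < 1"
    using params by simp_all
  have lt: "norm (u * v) < 1" if "norm u < 1" "norm v < 1" for u v :: complex
    using mult_strict_mono'[OF that] by (simp add: norm_mult)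
  have ab: "a * b * Q ^ k \<noteq> 1" and cd: "c * d * Q ^ k \<noteq> 1" for k
    using n1 Q by (intro mult_q_power_neq_1 lt; simp)+
  have X: "\<alpha> * b * c * d / Q * Q ^ k \<noteq> 1" for k
    using nondeg(3)[of k] Q by (simp add: Q_def field_simps)
  have W: "a * b * c * d / Q * Q ^ k \<noteq> 1" for k
  proof (cases k)
    case 0
    then show ?thesis using nondeg(2) Q by (simp add: Q_def)
  next
    case (Suc l)
    \<comment> \<open>for \<open>k > 0\<close> the power of \<open>q\<close> cancels the denominator, and \<open>|abcd| < 1\<close>\<close>
    have "a * b * c * d * Q ^ l \<noteq> 1"
      using n1 Q by (intro mult_q_power_neq_1 lt)
    then show ?thesis using Suc Q by (simp add: mult_ac)
  qed
  have aw: "askey_wilson n x \<alpha> b c d Q = aw_sum n \<alpha> b c d E Q" for n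
    unfolding x E_def using nondeg Q by (intro askey_wilson_eq_aw_sum) (auto simp: Q_def)
  define G where "G = expansion_term \<alpha> a b c d Q t (\<lambda>n. aw_sum n \<alpha> b c d E Q)"
  note gf = product_expansion[OF Q E(1) conv ab cd nondeg(1) X, folded G_def]
  have coeff: "(\<Sum>m. G n m) = t ^ n
        * qpochs [\<alpha> * b * c * d / Q,
                  csqrt (a * b * c * d / Q), - csqrt (a * b * c * d / Q),
                  csqrt (a * b * c * d), - csqrt (a * b * c * d)] Q n
        / qpochs [a * b, c * d, a * b * c * d / Q,
                  csqrt (\<alpha> * b * c * d / Q), - csqrt (\<alpha> * b * c * d / Q),
                  csqrt (\<alpha> * b * c * d), - csqrt (\<alpha> * b * c * d)] Q n
        * basic_hypergeom
            [a / \<alpha>, b * c * Q ^ n, b * d * Q ^ n, a * b * c * d * Q powi (2 * int n - 1)]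
            [a * b * Q ^ n, a * b * c * d * Q powi (int n - 1), \<alpha> * b * c * d * Q ^ (2 * n)]
            Q (\<alpha> * t)
        * (askey_wilson n x \<alpha> b c d Q / qpoch Q Q n)" for n
  proof -
    note g = expansion_term_column[OF Q X W, where u = "\<lambda>n. aw_sum n \<alpha> b c d E Q" and t = t, folded G_def]
    show ?thesis
      using suminf_factor[OF gf(2)[of n, unfolded g]]
      unfolding g aw basic_hypergeom_def by simp
  qed
  have prod: "(\<Sum>k. qpoch (a * E) Q k * qpoch (b * E) Q k / (qpoch Q Q k * qpoch (a * b) Q k) * (t / E) ^ k)
     = basic_hypergeom [a * E, b * E] [a * b] Q (t * (1 / E))"
    "(\<Sum>k. qpoch (c / E) Q k * qpoch (d / E) Q k / (qpoch Q Q k * qpoch (c * d) Q k) * (t * E) ^ k)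
     = basic_hypergeom [c * (1 / E), d * (1 / E)] [c * d] Q (t * E)"
    unfolding basic_hypergeom_def qpochs_def by simp_all
  have real: "complex_of_real (q ^ k) = Q ^ k" "complex_of_real (q powi i) = Q powi i" for k i
    by (simp_all add: Q_def of_real_power_int)
  show ?thesis
    unfolding real Q_def[symmetric] E_def[symmetric] E(2)
    using gf(1) unfolding coeff prod .
qed

end
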